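(* The decision problem 3-RS Colourability (given a graph $G$, decide whether $G$ admits a $3$-restricted star colouring) is solvable in polynomial time when the input is restricted to chordal graphs.
   Context: All graphs are finite, simple and undirected. A graph is chordal if it has no induced cycle of length greater than three. A $3$-restricted star colouring of $G$ is a map $f:V(G)\to\{0,1,2\}$ with $f(x)\neq f(y)$ for every edge $xy$ and with no path $x,y,z$ in $G$ (not necessarily induced) such that $f(y)>f(x)=f(z)$. *)

theory Defs
  imports Main "HOL-Computational_Algebra.Polynomial"
begin

section \<open>Graphs and restricted star colourings\<close>

record 'a graph =
  verts :: "'a set"
  edges :: "'a set set"

definition simple_graph :: "'a graph \<Rightarrow> bool" where
  "simple_graph G \<longleftrightarrow> finite (verts G) \<and> (\<forall>e\<in>edges G. e \<subseteq> verts G \<and> card e = 2)"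

text \<open>An induced cycle is given by listing its vertices in cyclic order.\<close>

definition induced_cycle :: "'a graph \<Rightarrow> 'a list \<Rightarrow> bool" where
  "induced_cycle G xs \<longleftrightarrow>
     3 \<le> length xs \<and> distinct xs \<and> set xs \<subseteq> verts G \<and>
     (\<forall>i<length xs. \<forall>j<length xs.
        {xs ! i, xs ! j} \<in> edges G \<longleftrightarrow>
        j = Suc i mod length xs \<or> i = Suc j mod length xs)"

definition chordal :: "'a graph \<Rightarrow> bool" where
  "chordal G \<longleftrightarrow> (\<forall>xs. induced_cycle G xs \<longrightarrow> length xs \<le> 3)"

definition rs3_colouring :: "'a graph \<Rightarrow> ('a \<Rightarrow> nat) \<Rightarrow> bool" where
  "rs3_colouring G f \<longleftrightarrow>
     f ` verts G \<subseteq> {0, 1, 2} \<and>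
     (\<forall>x y. {x, y} \<in> edges G \<longrightarrow> f x \<noteq> f y) \<and>
     \<not> (\<exists>x y z. {x, y} \<in> edges G \<and> {y, z} \<in> edges G \<and> x \<noteq> z \<and> f y > f x \<and> f x = f z)"

definition rs3_colourable :: "'a graph \<Rightarrow> bool" where
  "rs3_colourable G \<longleftrightarrow> (\<exists>f. rs3_colouring G f)"


section \<open>Polynomial time\<close>

text \<open>
  The machine model is a random access machine with structured control: a program works on
  finitely many unbounded arrays of natural numbers, named by natural numbers themselves.
  Every assignment and every evaluation of a test costs one unit. The arithmetic operations are
  addition and truncated subtraction only, and the expressions of a fixed program have bounded
  size. Hence the bit length of the stored numbers grows by at most a constant per step, and
  the functions computable in polynomial time are those of Turing machines. Multiplication
  at unit cost is left out on purpose, since it would break this equivalence.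
\<close>

datatype aexp =
    Const nat
  | Cell nat aexp
  | Plus aexp aexp
  | Monus aexp aexp

datatype bexp =
    Less aexp aexp
  | Neg bexp
  | Conj bexp bexp

datatype com =
    Skip
  | Assign nat aexp aexp
  | Seq com com
  | Cond bexp com com
  | While bexp com

type_synonym store = "nat \<Rightarrow> nat \<Rightarrow> nat"

fun aval :: "aexp \<Rightarrow> store \<Rightarrow> nat" where
  "aval (Const n) s = n"
| "aval (Cell a e) s = s a (aval e s)"
| "aval (Plus e1 e2) s = aval e1 s + aval e2 s"
| "aval (Monus e1 e2) s = aval e1 s - aval e2 s"

fun bval :: "bexp \<Rightarrow> store \<Rightarrow> bool" where
  "bval (Less e1 e2) s \<longleftrightarrow> aval e1 s < aval e2 s"
| "bval (Neg b) s \<longleftrightarrow> \<not> bval b s"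
| "bval (Conj b1 b2) s \<longleftrightarrow> bval b1 s \<and> bval b2 s"

text \<open>\<open>exec c s t s'\<close>: started in store \<open>s\<close>, program \<open>c\<close> halts after
  exactly \<open>t\<close> steps in store \<open>s'\<close>.\<close>

inductive exec :: "com \<Rightarrow> store \<Rightarrow> nat \<Rightarrow> store \<Rightarrow> bool" where
  exec_Skip: "exec Skip s 1 s"
| exec_Assign: "exec (Assign a i e) s 1 (s(a := (s a)(aval i s := aval e s)))"
| exec_Seq: "exec c1 s t1 s' \<Longrightarrow> exec c2 s' t2 s'' \<Longrightarrow> exec (Seq c1 c2) s (t1 + t2) s''"
| exec_Cond_True: "bval b s \<Longrightarrow> exec c1 s t s' \<Longrightarrow> exec (Cond b c1 c2) s (1 + t) s'"
| exec_Cond_False: "\<not> bval b s \<Longrightarrow> exec c2 s t s' \<Longrightarrow> exec (Cond b c1 c2) s (1 + t) s'"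
| exec_While_False: "\<not> bval b s \<Longrightarrow> exec (While b c) s 1 s"
| exec_While_True: "bval b s \<Longrightarrow> exec c s t1 s' \<Longrightarrow> exec (While b c) s' t2 s'' \<Longrightarrow>
    exec (While b c) s (1 + t1 + t2) s''"

lemma exec_deterministic: "exec c s t s' \<Longrightarrow> exec c s u s'' \<Longrightarrow> u = t \<and> s'' = s'"
proof (induction arbitrary: u s'' rule: exec.induct)
  case (exec_Seq c1 s t1 s1 c2 t2 s2)
  from exec_Seq.prems show ?case
    by cases (use exec_Seq.IH in blast)
next
  case (exec_While_True b s c t1 s1 t2 s2)
  from exec_While_True.prems show ?case
    by cases (use exec_While_True.IH exec_While_True.hyps in blast)+
qed (erule exec.cases; auto)+

text \<open>The input bits are in array \<open>0\<close> and their number is in cell \<open>0\<close> of array \<open>1\<close>; all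
  other cells are \<open>0\<close>.\<close>

definition initial_store :: "bool list \<Rightarrow> store" where
  "initial_store w = (\<lambda>a i.
     if a = 0 \<and> i < length w then of_bool (w ! i)
     else if a = 1 \<and> i = 0 then length w
     else 0)"

text \<open>\<open>poly_time_solvable enc I Q\<close>: the problem of deciding \<open>Q\<close> on the instances in \<open>I\<close> is solvable
  in polynomial time, where \<open>enc x w\<close> says that the word \<open>w\<close> encodes the instance \<open>x\<close>. The
  answer is read off from cell \<open>0\<close> of array \<open>1\<close>. Nothing is required of the program on words that
  do not encode an instance in \<open>I\<close>.\<close>

definition poly_time_solvable ::
  "('i \<Rightarrow> bool list \<Rightarrow> bool) \<Rightarrow> 'i set \<Rightarrow> ('i \<Rightarrow> bool) \<Rightarrow> bool" where
  "poly_time_solvable enc I Q \<longleftrightarrow>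
     (\<exists>(c :: com) (p :: nat poly). \<forall>x\<in>I. \<forall>w. enc x w \<longrightarrow>
        (\<exists>t s. exec c (initial_store w) t s \<and> t \<le> poly p (length w) \<and>
               (s 1 0 \<noteq> 0 \<longleftrightarrow> Q x)))"

text \<open>A graph is encoded by its adjacency matrix, row by row, with respect to an arbitrary
  ordering of its vertices. The word does not depend on the names of the vertices.\<close>

definition adjacency_word :: "'a graph \<Rightarrow> 'a list \<Rightarrow> bool list" where
  "adjacency_word G xs = concat (map (\<lambda>x. map (\<lambda>y. {x, y} \<in> edges G) xs) xs)"

definition encodes_graph :: "'a graph \<Rightarrow> bool list \<Rightarrow> bool" where
  "encodes_graph G w \<longleftrightarrow>
     (\<exists>xs. distinct xs \<and> set xs = verts G \<and> w = adjacency_word G xs)"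

end

theory Submission
  imports Defs
begin

text \<open>
  A vertex of colour 2 has at most one neighbour of each of the colours 0 and 1, so its degree is at
  most 2. Hence every triangle of a colourable graph contains a vertex of degree 2. Delete from every
  triangle one such vertex, to be coloured 2, and forbid colour 2 on the remaining vertices of
  triangles. This does not affect colourability: two vertices of degree 2 in the same triangle are
  interchangeable. A chordal graph without triangles is a forest: an end of a longest induced path is
  a leaf. On the forest, give each vertex a state, consisting of its colour \<open>c\<close> and a vertex \<open>p\<close>
  that is its only neighbour of colour 0, if there is one. The conditions on a colouring become conditions
  on the states of adjacent vertices, and a binary constraint problem on a forest is solvable as soon as
  it has a nonempty arc consistent set of states at every vertex. The largest arc consistent set is
  computed by repeatedly discarding states without support, in at most \<open>3n\<^sup>2\<close> rounds.
\<close>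

section \<open>Forests and arc consistency\<close>

text \<open>The condition on a path \<open>x, y, z\<close> involves three vertices, whereas arc
  consistency handles binary constraints. A common colour 0 of \<open>x\<close> and \<open>z\<close>
  is excluded by the pointer \<open>p\<close> of \<open>y\<close>: both ends would have to equal it.
  A common colour 1 below a \<open>y\<close> of colour 2 needs no second pointer: if the pointer,
  whenever it is a neighbour, has colour 0, then all other neighbours of \<open>y\<close> have
  colour 1, and that there is at most one of them is a condition on the graph alone. All three
  colours occur in a triangle, so a vertex of colour 2 is unavoidable there. Which corner of low
  degree takes this role is immaterial, so it can be fixed without knowing a colouring, by least
  index. On the machine side, every test is a first-order formula over the vertices with a fixed
  number of quantifiers. Compiled to nested loops, it runs in polynomial time, by recursion on the
  formula. The factor 3 in the number of rounds is the number of colours: there are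
  \<open>3 * n * n\<close> states, and a round that discards none is the last one needed.\<close>

definition induced_path_rel :: "('a \<Rightarrow> 'a \<Rightarrow> bool) \<Rightarrow> 'a list \<Rightarrow> bool" where
  "induced_path_rel R xs \<longleftrightarrow> distinct xs \<and>
     (\<forall>i<length xs. \<forall>j<length xs. R (xs ! i) (xs ! j) \<longleftrightarrow> j = Suc i \<or> i = Suc j)"

definition induced_cycle_rel :: "('a \<Rightarrow> 'a \<Rightarrow> bool) \<Rightarrow> 'a list \<Rightarrow> bool" where
  "induced_cycle_rel R xs \<longleftrightarrow> 3 \<le> length xs \<and> distinct xs \<and>
     (\<forall>i<length xs. \<forall>j<length xs. R (xs ! i) (xs ! j) \<longleftrightarrow>
        j = Suc i mod length xs \<or> i = Suc j mod length xs)"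

lemma induced_path_extend:
  assumes sym: "\<And>x y. R x y \<Longrightarrow> R y x" and irr: "\<And>x. \<not> R x x"
    and p: "induced_path_rel R xs" and "xs \<noteq> []" and y: "y \<notin> set xs"
    and "R y (xs ! 0)" and no: "\<And>i. 0 < i \<Longrightarrow> i < length xs \<Longrightarrow> \<not> R y (xs ! i)"
  shows "induced_path_rel R (y # xs)"
  unfolding induced_path_rel_def
proof (intro conjI allI impI)
  show "distinct (y # xs)" using p y by (simp add: induced_path_rel_def)
  fix i j assume ij: "i < length (y # xs)" "j < length (y # xs)"
  have adj: "R y (xs ! k) \<longleftrightarrow> k = 0" if "k < length xs" for k
    using no that \<open>R y (xs ! 0)\<close> by blast
  have adj': "R (xs ! k) y \<longleftrightarrow> k = 0" if "k < length xs" for k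
    using adj that sym by blast
  show "R ((y # xs) ! i) ((y # xs) ! j) \<longleftrightarrow> j = Suc i \<or> i = Suc j"
    using ij p irr by (cases i; cases j) (auto simp: adj adj' induced_path_rel_def)
qed

text \<open>\<open>k\<close> is the first contact of \<open>y\<close> with the path after
  \<open>xs ! 0\<close>, so the cycle has no chord at \<open>y\<close>, and the path has none of its
  own. For \<open>k = 1\<close> the cycle is a triangle.\<close>

lemma induced_path_close:
  assumes sym: "\<And>x y. R x y \<Longrightarrow> R y x" and irr: "\<And>x. \<not> R x x"
    and p: "induced_path_rel R xs" and y: "y \<notin> set xs"
    and k: "0 < k" "k < length xs" and adj0: "R y (xs ! 0)" and adjk: "R y (xs ! k)"
    and no: "\<And>i. 0 < i \<Longrightarrow> i < k \<Longrightarrow> \<not> R y (xs ! i)"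
  shows "induced_cycle_rel R (y # take (Suc k) xs)"
proof -
  let ?c = "y # take (Suc k) xs"
  have len: "length ?c = k + 2" using k by simp
  have adj: "R y (xs ! i) \<longleftrightarrow> i = 0 \<or> i = k" if "i \<le> k" for i
    using no that adj0 adjk by (metis le_neq_implies_less not_gr_zero)
  have adj': "R (xs ! i) y \<longleftrightarrow> i = 0 \<or> i = k" if "i \<le> k" for i
    using adj that sym by blast
  have inner: "R (xs ! i) (xs ! j) \<longleftrightarrow> j = Suc i \<or> i = Suc j" if "i \<le> k" "j \<le> k" for i j
    using p that k by (auto simp: induced_path_rel_def)
  have smod: "Suc i mod (k + 2) = (if i = Suc k then 0 else Suc i)" if "i < k + 2" for i
    using that by auto
  have "R (?c ! i) (?c ! j) \<longleftrightarrow> j = Suc i mod (k + 2) \<or> i = Suc j mod (k + 2)"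
    if "i < k + 2" "j < k + 2" for i j
    unfolding smod[OF that(1)] smod[OF that(2)]
    using that irr k by (cases i; cases j) (auto simp: adj adj' inner)
  moreover have "distinct ?c"
    using p y by (auto simp: induced_path_rel_def dest: in_set_takeD)
  ultimately show ?thesis
    using len k unfolding induced_cycle_rel_def by simp
qed

text \<open>Maximality does the work: a neighbour of the end \<open>xs ! 0\<close> other than
  \<open>xs ! 1\<close> lies off the path. If it touches the path again, it closes an induced cycle;
  otherwise it prolongs the path.\<close>

lemma leaf_exists:
  assumes fin: "finite V" and ne: "V \<noteq> {}"
    and sym: "\<And>x y. R x y \<Longrightarrow> R y x" and irr: "\<And>x. \<not> R x x"
    and acyclic: "\<And>xs. set xs \<subseteq> V \<Longrightarrow> \<not> induced_cycle_rel R xs"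
  shows "\<exists>u\<in>V. \<forall>x\<in>V. \<forall>y\<in>V. R u x \<longrightarrow> R u y \<longrightarrow> x = y"
proof -
  define P where "P = (\<lambda>xs. xs \<noteq> [] \<and> set xs \<subseteq> V \<and> induced_path_rel R xs)"
  obtain v where "v \<in> V" using ne by blast
  then have "P [v]" using irr by (auto simp: P_def induced_path_rel_def)
  moreover have "\<forall>xs. P xs \<longrightarrow> length xs < Suc (card V)"
    using fin by (auto simp: P_def induced_path_rel_def less_Suc_eq_le)
      (metis card_mono distinct_card)
  ultimately obtain xs where xs: "P xs" and max: "\<And>ys. P ys \<Longrightarrow> length ys \<le> length xs"
    using ex_has_greatest_nat[of P "[v]" length] by blast
  have path: "induced_path_rel R xs" and nonempty: "xs \<noteq> []" and sub: "set xs \<subseteq> V"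
    using xs by (auto simp: P_def)
  show ?thesis
  proof (rule bexI[of _ "xs ! 0"])
    show "xs ! 0 \<in> V" using sub nonempty by auto
    show "\<forall>x\<in>V. \<forall>y\<in>V. R (xs ! 0) x \<longrightarrow> R (xs ! 0) y \<longrightarrow> x = y"
    proof (rule ccontr)
      assume "\<not> ?thesis"
      \<comment> \<open>Of two different neighbours of \<open>xs ! 0\<close>, at least one is not
        \<open>xs ! 1\<close>.\<close>
      then obtain y where y: "y \<in> V" "R (xs ! 0) y" and y1: "\<not> (1 < length xs \<and> y = xs ! 1)"
        by metis
      have notin: "y \<notin> set xs"
      proof
        assume "y \<in> set xs"
        then obtain j where "j < length xs" "y = xs ! j" by (metis in_set_conv_nth)
        then show False using path y y1 nonempty by (auto simp: induced_path_rel_def)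
      qed
      show False
      proof (cases "\<exists>i. 0 < i \<and> i < length xs \<and> R y (xs ! i)")
        case True
        define k where "k = (LEAST i. 0 < i \<and> i < length xs \<and> R y (xs ! i))"
        have k: "0 < k" "k < length xs" "R y (xs ! k)"
          using LeastI_ex[OF True] unfolding k_def by auto
        have "\<not> R y (xs ! i)" if "0 < i" "i < k" for i
          using not_less_Least[of i "\<lambda>i. 0 < i \<and> i < length xs \<and> R y (xs ! i)"] that k(2)
          unfolding k_def by auto
        then have "induced_cycle_rel R (y # take (Suc k) xs)"
          using induced_path_close[OF sym irr path notin k(1,2) sym[OF y(2)] k(3)] by blast
        moreover have "set (y # take (Suc k) xs) \<subseteq> V"
          using y sub by (auto dest: in_set_takeD)
        ultimately show False using acyclic by blast
      next
        case False
        then have "P (y # xs)"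
          using induced_path_extend[OF sym irr path nonempty notin sym[OF y(2)]] y(1) sub
          by (auto simp: P_def)
        then show False using max by fastforce
      qed
    qed
  qed
qed

text \<open>All hypotheses survive the removal of a leaf \<open>u\<close>, with the same domains. A
  solution on the rest extends to \<open>u\<close>, since only the value at the one neighbour of
  \<open>u\<close> has to be matched and that value has support in \<open>D u\<close>.\<close>

lemma arc_consistent_forest_solvable:
  assumes "finite V"
    and sym: "\<And>x y. R x y \<Longrightarrow> R y x" and irr: "\<And>x. \<not> R x x"
    and acyclic: "\<And>xs. set xs \<subseteq> V \<Longrightarrow> \<not> induced_cycle_rel R xs"
    and dom: "\<And>v. v \<in> V \<Longrightarrow> D v \<noteq> {}"
    and arc: "\<And>v w s. v \<in> V \<Longrightarrow> w \<in> V \<Longrightarrow> R v w \<Longrightarrow> s \<in> D v \<Longrightarrow> \<exists>t\<in>D w. C v s w t"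
    and Csym: "\<And>v s w t. C v s w t \<Longrightarrow> C w t v s"
  shows "\<exists>g. \<forall>v\<in>V. g v \<in> D v \<and> (\<forall>w\<in>V. R v w \<longrightarrow> C v (g v) w (g w))"
  using assms(1) acyclic dom arc
proof (induction V rule: finite_psubset_induct)
  case (psubset V)
  show ?case
  proof (cases "V = {}")
    case False
    obtain u where u: "u \<in> V" and leaf: "\<And>x y. x \<in> V \<Longrightarrow> y \<in> V \<Longrightarrow> R u x \<Longrightarrow> R u y \<Longrightarrow> x = y"
      using leaf_exists[OF psubset.hyps False sym irr psubset.prems(1)] by blast
    have "\<exists>g. \<forall>v\<in>V - {u}. g v \<in> D v \<and> (\<forall>w\<in>V - {u}. R v w \<longrightarrow> C v (g v) w (g w))"
    proof (rule psubset.IH)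
      show "V - {u} \<subset> V" using u by blast
      show "\<And>xs. set xs \<subseteq> V - {u} \<Longrightarrow> \<not> induced_cycle_rel R xs"
        using psubset.prems(1) by blast
    qed (use psubset.prems in auto)
    then obtain g where g: "\<And>v. v \<in> V - {u} \<Longrightarrow> g v \<in> D v"
      "\<And>v w. v \<in> V - {u} \<Longrightarrow> w \<in> V - {u} \<Longrightarrow> R v w \<Longrightarrow> C v (g v) w (g w)"
      by blast
    obtain t where t: "t \<in> D u" "\<And>w. w \<in> V \<Longrightarrow> R u w \<Longrightarrow> C w (g w) u t"
    proof (cases "\<exists>w\<in>V. R u w")
      case True
      then obtain w where w: "w \<in> V" "R u w" by blast
      then have "w \<in> V - {u}" using irr by blast
      then obtain t where "t \<in> D u" "C w (g w) u t"
        using psubset.prems(3)[of w u "g w"] w u g(1) sym by blast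
      then show ?thesis using that leaf w by blast
    next
      case False
      then show ?thesis using that psubset.prems(2)[OF u] by blast
    qed
    show ?thesis
    proof (intro exI ballI conjI impI)
      fix v assume "v \<in> V"
      then show "(g(u := t)) v \<in> D v" using g t by auto
      fix w assume "w \<in> V" "R v w"
      moreover have "\<not> (v = u \<and> w = u)" using irr \<open>R v w\<close> by blast
      ultimately show "C v ((g(u := t)) v) w ((g(u := t)) w)"
        using \<open>v \<in> V\<close> g(2)[of v w] t(2)[of v] Csym[OF t(2)[of w]] sym[of v w]
        by (cases "v = u"; cases "w = u") auto
    qed
  qed simp
qed

section \<open>Removing triangles, and colourings as arc consistent sets of states\<close>

definition rs_colouring_rel :: "'a set \<Rightarrow> ('a \<Rightarrow> 'a \<Rightarrow> bool) \<Rightarrow> ('a \<Rightarrow> nat) \<Rightarrow> bool" where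
  "rs_colouring_rel V R f \<longleftrightarrow> f ` V \<subseteq> {0, 1, 2} \<and> (\<forall>x y. R x y \<longrightarrow> f x \<noteq> f y) \<and>
     \<not> (\<exists>x y z. R x y \<and> R y z \<and> x \<noteq> z \<and> f y > f x \<and> f x = f z)"

lemma rs_colouring_rel_range: "rs_colouring_rel V R f \<Longrightarrow> v \<in> V \<Longrightarrow> f v = 0 \<or> f v = 1 \<or> f v = 2"
  unfolding rs_colouring_rel_def by auto

locale indexed_graph =
  fixes n :: nat and E :: "nat \<Rightarrow> nat \<Rightarrow> bool"
  assumes E_less: "E x y \<Longrightarrow> x < n" and E_sym: "E x y \<Longrightarrow> E y x" and E_irrefl: "\<not> E x x"
begin

definition triangle :: "nat \<Rightarrow> nat \<Rightarrow> nat \<Rightarrow> bool" where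
  "triangle a b c \<longleftrightarrow> E a b \<and> E b c \<and> E a c"

definition degree_ge3 :: "nat \<Rightarrow> bool" where
  "degree_ge3 v \<longleftrightarrow> (\<exists>a b c. E v a \<and> E v b \<and> E v c \<and> a \<noteq> b \<and> b \<noteq> c \<and> a \<noteq> c)"

definition in_triangle :: "nat \<Rightarrow> bool" where
  "in_triangle v \<longleftrightarrow> (\<exists>a b. triangle v a b)"

text \<open>A triangle vertex without three neighbours lies in one triangle only, so this selects
  the corner of low degree with the least index. The tie-break by index makes the choice expressible
  by a formula.\<close>

definition deleted :: "nat \<Rightarrow> bool" where
  "deleted v \<longleftrightarrow> \<not> degree_ge3 v \<and>
     (\<exists>a b. triangle v a b \<and> (degree_ge3 a \<or> v < a) \<and> (degree_ge3 b \<or> v < b))"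

definition kept_edge :: "nat \<Rightarrow> nat \<Rightarrow> bool" where
  "kept_edge v w \<longleftrightarrow> E v w \<and> \<not> deleted v \<and> \<not> deleted w"

definition triangles_ok :: bool where
  "triangles_ok \<longleftrightarrow> (\<forall>a b c. triangle a b c \<longrightarrow> \<not> (degree_ge3 a \<and> degree_ge3 b \<and> degree_ge3 c))"

text \<open>The part of the constraint on colour 2 that depends on the graph alone: the neighbours
  other than the pointer will have colour 1. Using \<open>E\<close> instead of
  \<open>kept_edge\<close> makes no difference here, since an edge to a deleted vertex lies in a
  triangle.\<close>

definition legal :: "nat \<Rightarrow> nat \<Rightarrow> nat \<Rightarrow> bool" where
  "legal c v p \<longleftrightarrow> (c = 2 \<longrightarrow> \<not> in_triangle v \<and>
     (\<forall>x y. E v x \<and> E v y \<and> x \<noteq> p \<and> y \<noteq> p \<longrightarrow> x = y))"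

text \<open>The demand of a vertex in state \<open>(c, p)\<close> on a neighbour \<open>w\<close> of
  colour \<open>d\<close>. The last clause makes a pointer to a neighbour honest, so that the other
  neighbours of a vertex of colour 2 have colour 1. For \<open>c = 1\<close> a pointer to a
  neighbour of another colour does no harm.\<close>

definition tolerates :: "nat \<Rightarrow> nat \<Rightarrow> nat \<Rightarrow> nat \<Rightarrow> bool" where
  "tolerates c p w d \<longleftrightarrow> c \<noteq> d \<and> (c \<noteq> 0 \<longrightarrow> d = 0 \<longrightarrow> w = p) \<and> (c = 2 \<longrightarrow> w = p \<longrightarrow> d = 0)"

definition states :: "(nat \<times> nat \<times> nat) set" where
  "states = {..<3} \<times> {..<n} \<times> {..<n}"

definition supported :: "(nat \<times> nat \<times> nat) set \<Rightarrow> nat \<Rightarrow> nat \<Rightarrow> nat \<Rightarrow> bool" where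
  "supported A c v p \<longleftrightarrow> legal c v p \<and>
     (\<forall>w. kept_edge v w \<longrightarrow> (\<exists>d q. (d, w, q) \<in> A \<and> tolerates c p w d \<and> tolerates d q v c))"

definition arc_consistent :: "(nat \<times> nat \<times> nat) set \<Rightarrow> bool" where
  "arc_consistent A \<longleftrightarrow> (\<forall>c v p. (c, v, p) \<in> A \<longrightarrow> supported A c v p)"

definition covers :: "(nat \<times> nat \<times> nat) set \<Rightarrow> bool" where
  "covers A \<longleftrightarrow> (\<forall>v<n. deleted v \<or> (\<exists>c p. (c, v, p) \<in> A))"

lemma kept_edge_sym: "kept_edge v w \<Longrightarrow> kept_edge w v"
  using E_sym by (auto simp: kept_edge_def)

lemma low_degreeD:
  assumes "\<not> degree_ge3 v" "triangle v a b" "E v x"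
  shows "x = a \<or> x = b"
  using assms E_irrefl unfolding degree_ge3_def triangle_def by metis

lemma triangle_perm:
  "triangle a b c \<Longrightarrow> triangle b a c" "triangle a b c \<Longrightarrow> triangle a c b"
  using E_sym by (auto simp: triangle_def)

text \<open>\<open>deleted\<close> speaks of some triangle, but low degree makes it the given one.
  Two deleted corners would both have low degree, and each would need the smaller index.\<close>

lemma deletedD:
  assumes "deleted v" "triangle v a b"
  shows "\<not> deleted a \<and> \<not> deleted b \<and> (degree_ge3 a \<or> v < a) \<and> (degree_ge3 b \<or> v < b)"
proof -
  have key: "(degree_ge3 a \<or> v < a) \<and> (degree_ge3 b \<or> v < b)"
    if "deleted v" "triangle v a b" for v a b
  proof -
    obtain a' b' where 1: "triangle v a' b'" "degree_ge3 a' \<or> v < a'" "degree_ge3 b' \<or> v < b'"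
      and 2: "\<not> degree_ge3 v"
      using \<open>deleted v\<close> unfolding deleted_def by blast
    have "a = a' \<or> a = b'" "b = a' \<or> b = b'"
      using low_degreeD[OF 2 1(1)] that(2) unfolding triangle_def by blast+
    then show ?thesis using 1 by blast
  qed
  have "\<not> degree_ge3 v" using assms unfolding deleted_def by blast
  have "\<not> deleted a"
    using key[OF assms] key[OF _ triangle_perm(1)[OF assms(2)]] \<open>\<not> degree_ge3 v\<close>
    by (metis deleted_def not_less_iff_gr_or_eq)
  moreover have "\<not> deleted b"
    using key[OF assms] key[OF _ triangle_perm(1)[OF triangle_perm(2)[OF assms(2)]]] \<open>\<not> degree_ge3 v\<close>
    by (metis deleted_def not_less_iff_gr_or_eq)
  ultimately show ?thesis using key[OF assms] by blast
qed

text \<open>The only neighbours of a deleted vertex are the other corners of its triangle.\<close>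

lemma deleted_neighbour:
  assumes "deleted c" "E c a"
  obtains b where "triangle c a b"
proof -
  obtain x y where xy: "triangle c x y" using assms(1) unfolding deleted_def by blast
  then have "a = x \<or> a = y" using low_degreeD assms unfolding deleted_def by blast
  then show thesis using that xy triangle_perm(2) by blast
qed

text \<open>By \<open>triangles_ok\<close> some corner has fewer than three neighbours; the least
  such corner is deleted.\<close>

lemma triangle_has_deleted:
  assumes ok: "triangles_ok" and t: "triangle a b c"
  shows "deleted a \<or> deleted b \<or> deleted c"
proof -
  define L where "L = {x \<in> {a, b, c}. \<not> degree_ge3 x}"
  have "finite L" unfolding L_def by simp
  have "L \<noteq> {}" using ok t unfolding L_def triangles_ok_def by blast

  with \<open>finite L\<close> have m: "Min L \<in> L" "\<And>x. x \<in> L \<Longrightarrow> Min L \<le> x" by simp_all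
  have t': "triangle b a c" "triangle c a b" using t triangle_perm by blast+
  have d: "a \<noteq> b" "a \<noteq> c" "b \<noteq> c" using t E_irrefl unfolding triangle_def by auto
  have "x \<noteq> Min L \<Longrightarrow> x \<in> {a, b, c} \<Longrightarrow> degree_ge3 x \<or> Min L < x" for x
    using m(2)[of x] unfolding L_def by fastforce
  then have "deleted (Min L)"
    using m(1) t t' d unfolding deleted_def L_def by (smt (verit) insert_iff mem_Collect_eq singletonD)
  then show ?thesis using m(1) unfolding L_def by auto
qed

lemma colour2_low_degree:
  assumes f: "rs_colouring_rel {..<n} E f" and "f v = 2"
  shows "\<not> degree_ge3 v"
proof
  assume "degree_ge3 v"
  then obtain a b c where abc: "E v a" "E v b" "E v c" "a \<noteq> b" "b \<noteq> c" "a \<noteq> c"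
    unfolding degree_ge3_def by blast
  have range: "f x = 0 \<or> f x = 1" if "E v x" for x
    using f that E_less[OF E_sym[OF that]] \<open>f v = 2\<close> unfolding rs_colouring_rel_def by fastforce
  have inj: "f x \<noteq> f y" if "E v x" "E v y" "x \<noteq> y" for x y
  proof
    assume "f x = f y"
    moreover have "f x < f v" using range[OF that(1)] \<open>f v = 2\<close> by auto
    ultimately show False
      using f that E_sym[OF that(1)] unfolding rs_colouring_rel_def by blast
  qed
  show False using range[OF abc(1)] range[OF abc(2)] range[OF abc(3)] inj abc by metis
qed

lemma triangle_has_colour2:
  assumes f: "rs_colouring_rel {..<n} E f" and t: "triangle a b c"
  shows "f a = 2 \<or> f b = 2 \<or> f c = 2"
proof -
  have "f a \<in> {0,1,2}" "f b \<in> {0,1,2}" "f c \<in> {0,1,2}"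
    using f t E_less E_sym unfolding rs_colouring_rel_def triangle_def by (meson image_subset_iff lessThan_iff)+
  moreover have "f a \<noteq> f b" "f b \<noteq> f c" "f a \<noteq> f c"
    using f t unfolding rs_colouring_rel_def triangle_def by auto
  ultimately show ?thesis by auto
qed

lemma colouring_triangles_ok:
  assumes "rs_colouring_rel {..<n} E f"
  shows "triangles_ok"
  using colour2_low_degree triangle_has_colour2 assms unfolding triangles_ok_def by metis

text \<open>The interchange of equivalent vertices, done in all triangles at once: \<open>g\<close>
  moves an undeleted triangle vertex of colour 2 to a deleted corner of its triangle. On the
  undeleted vertices \<open>g\<close> is injective and maps kept edges to edges, so
  \<open>f \<circ> g\<close> inherits the colouring conditions.\<close>

lemma kept_colouring_exists:
  assumes f: "rs_colouring_rel {..<n} E f"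
  obtains h where "rs_colouring_rel {..<n} kept_edge h"
    "\<And>v. \<not> deleted v \<Longrightarrow> h v = 2 \<Longrightarrow> \<not> in_triangle v \<and> \<not> degree_ge3 v"
proof -
  define twin where "twin = (\<lambda>v c. deleted c \<and> (\<exists>a. triangle v c a))"
  define g where "g = (\<lambda>v. if f v = 2 \<and> \<not> deleted v \<and> in_triangle v then SOME c. twin v c else v)"
  have twin: "twin v (g v)" if "f v = 2" "\<not> deleted v" "in_triangle v" for v
  proof -
    have "\<exists>c. twin v c"
      using that triangle_has_deleted[OF colouring_triangles_ok[OF f]] triangle_perm
      unfolding twin_def in_triangle_def by metis
    then show ?thesis using that by (simp add: g_def someI_ex)
  qed
  have g_id: "g v = v" if "\<not> (f v = 2 \<and> \<not> deleted v \<and> in_triangle v)" for v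
    using that by (auto simp: g_def)
  have g_less: "g v < n" if "v < n" for v
    using twin[of v] g_id[of v] that E_less E_sym unfolding twin_def triangle_def by metis
  \<comment> \<open>A moved \<open>v\<close> has colour 2, hence low degree, so its neighbours are
    \<open>g v\<close> and the third corner \<open>a\<close>. As \<open>g v\<close> is deleted,
    \<open>w\<close> is \<open>a\<close>.\<close>
  have nbr: "E (g v) w" if "E v w" "\<not> deleted w" "\<not> deleted v" for v w
  proof (cases "f v = 2 \<and> in_triangle v")
    case True
    then have "twin v (g v)" using twin that by blast
    then obtain a where a: "deleted (g v)" "triangle v (g v) a" unfolding twin_def by blast
    have "\<not> degree_ge3 v" using True f colour2_low_degree by blast
    then have "w = a" using low_degreeD a that by blast
    then show ?thesis using a(2) unfolding triangle_def by blast
  qed (use g_id that in auto)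
  have hom: "E (g v) (g w)" if k: "kept_edge v w" for v w
  proof -
    have "f v \<noteq> f w" using f k unfolding rs_colouring_rel_def kept_edge_def by blast
    \<comment> \<open>Only vertices of colour 2 move, so adjacent vertices do not both move.\<close>
    then have "g v = v \<or> g w = w" using g_id by metis
    then show ?thesis using nbr k E_sym unfolding kept_edge_def by metis
  qed
  \<comment> \<open>Two distinct vertices with a common image are both moved to it. The image has
    low degree, so they are the two other corners of its triangle: adjacent, yet both of colour
    2.\<close>
  have g_inj: "v = w" if "g v = g w" "\<not> deleted v" "\<not> deleted w" for v w
  proof (rule ccontr)
    assume ne: "v \<noteq> w"
    have tw: "twin v (g v)" if "g v \<noteq> v" for v using that twin g_id by blast
    have dv: "deleted (g v)" using tw[of v] tw[of w] that ne unfolding twin_def by metis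
    then have v: "twin v (g v)" "twin w (g v)" using tw[of v] tw[of w] that by metis+
    have fv: "f v = 2" "f w = 2" using dv that g_id by metis+
    obtain a where a: "triangle v (g v) a" using v(1) unfolding twin_def by blast
    have "E (g v) w" using v(2) E_sym unfolding twin_def triangle_def by blast
    then have "w = v \<or> w = a"
      using low_degreeD[of "g v" v a w] dv triangle_perm a unfolding deleted_def by blast
    then have "E v w" using ne a unfolding triangle_def by blast
    then show False using fv f unfolding rs_colouring_rel_def by metis
  qed
  show thesis
  proof (rule that)
    show "rs_colouring_rel {..<n} kept_edge (f \<circ> g)"
      unfolding rs_colouring_rel_def
    proof (intro conjI notI allI impI)
      show "(f \<circ> g) ` {..<n} \<subseteq> {0, 1, 2}"
      proof
        fix y assume "y \<in> (f \<circ> g) ` {..<n}"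
        then obtain x where "y = f (g x)" "g x < n" using g_less by auto
        then show "y \<in> {0, 1, 2}" using rs_colouring_rel_range[OF f, of "g x"] by auto
      qed
      show "(f \<circ> g) x = (f \<circ> g) y \<Longrightarrow> False" if "kept_edge x y" for x y
        using hom[OF that] f unfolding rs_colouring_rel_def comp_apply by blast
      assume "\<exists>x y z. kept_edge x y \<and> kept_edge y z \<and> x \<noteq> z \<and>
          (f \<circ> g) x < (f \<circ> g) y \<and> (f \<circ> g) x = (f \<circ> g) z"
      then obtain x y z where xyz: "kept_edge x y" "kept_edge y z" "x \<noteq> z"
          "f (g x) < f (g y)" "f (g x) = f (g z)" by auto
      then have "g x \<noteq> g z" using g_inj unfolding kept_edge_def by blast
      then show False using f hom xyz unfolding rs_colouring_rel_def by blast
    qed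
    fix v assume v: "\<not> deleted v" "(f \<circ> g) v = 2"
    \<comment> \<open>Otherwise \<open>v\<close> was moved to a neighbour, whose colour under
      \<open>f\<close> is not 2.\<close>
    have "\<not> (f v = 2 \<and> in_triangle v)"
    proof
      assume a: "f v = 2 \<and> in_triangle v"
      then have "E v (g v)" using twin v unfolding twin_def triangle_def by blast
      then show False using f a v unfolding rs_colouring_rel_def by (metis comp_apply)
    qed
    then show "\<not> in_triangle v \<and> \<not> degree_ge3 v"
      using v g_id colour2_low_degree[OF f] by (metis comp_apply)
  qed
qed

text \<open>One state for each undeleted vertex is enough: its colour after the interchange, with
  its neighbour of colour 0 as pointer.\<close>

lemma colouring_imp_arc_consistent:
  assumes f: "rs_colouring_rel {..<n} E f"
  shows "\<exists>A\<subseteq>states. arc_consistent A \<and> covers A"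
proof -
  obtain h where h: "rs_colouring_rel {..<n} kept_edge h"
    and h2: "\<And>v. \<not> deleted v \<Longrightarrow> h v = 2 \<Longrightarrow> \<not> in_triangle v \<and> \<not> degree_ge3 v"
    using kept_colouring_exists[OF f] by blast
  \<comment> \<open>The default pointer is \<open>v\<close> itself: it is in range and never
    adjacent to \<open>v\<close>, so the clause of \<open>tolerates\<close> that assumes
    \<open>w = p\<close> cannot apply.\<close>
  define ptr where "ptr = (\<lambda>v. if \<exists>w. kept_edge v w \<and> h w = 0 then SOME w. kept_edge v w \<and> h w = 0 else v)"
  define A where "A = {(h v, v, ptr v) | v. v < n \<and> \<not> deleted v}"
  have ptr: "kept_edge v (ptr v) \<and> h (ptr v) = 0" if "kept_edge v w" "h w = 0" for v w
  proof -
    have "\<exists>w. kept_edge v w \<and> h w = 0" using that by blast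
    then show ?thesis unfolding ptr_def by (auto intro: someI2_ex)
  qed
  have kept_less: "w < n" if "kept_edge v w" for v w
    using that E_less E_sym unfolding kept_edge_def by blast
  have ptr_less: "ptr v < n" if "v < n" for v
  proof (cases "\<exists>w. kept_edge v w \<and> h w = 0")
    case True
    then obtain w where "kept_edge v w" "h w = 0" by blast
    from ptr[OF this] show ?thesis by (blast intro: kept_less)
  next
    case False
    then have "ptr v = v" unfolding ptr_def by (rule if_not_P)
    then show ?thesis using that by simp
  qed
  have hr: "h v = 0 \<or> h v = 1 \<or> h v = 2" if "v < n" for v
    using h that unfolding rs_colouring_rel_def by auto
  have proper: "h v \<noteq> h w" if "kept_edge v w" for v w
    using h that unfolding rs_colouring_rel_def by blast
  have uniq: "x = y" if "kept_edge v x" "kept_edge v y" "h x = h y" "h x < h v" for v x y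
    using h that(2-4) kept_edge_sym[OF that(1)] unfolding rs_colouring_rel_def by blast
  have "A \<subseteq> states"
  proof
    fix t assume "t \<in> A"
    then obtain v where "t = (h v, v, ptr v)" "v < n" unfolding A_def by blast
    then show "t \<in> states" using ptr_less[OF \<open>v < n\<close>] hr[OF \<open>v < n\<close>] unfolding states_def by auto
  qed
  moreover have "covers A" unfolding covers_def A_def by auto
  moreover have "arc_consistent A"
    unfolding arc_consistent_def
  proof (intro allI impI)
    fix c v p assume "(c, v, p) \<in> A"
    then have v: "c = h v" "p = ptr v" "v < n" "\<not> deleted v" unfolding A_def by auto
    have tol: "tolerates (h x) (ptr x) y (h y)" if xy: "kept_edge x y" for x y
    proof -
      have "y = ptr x" if "h y = 0" "h x \<noteq> 0"
        by (rule uniq[OF xy]) (use ptr[OF xy that(1)] that in simp_all)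
      moreover have "h y = 0" if "y = ptr x"
      proof (cases "\<exists>w. kept_edge x w \<and> h w = 0")
        case True
        then obtain w where "kept_edge x w" "h w = 0" by blast
        from ptr[OF this] show ?thesis using that by simp
      next
        case False
        then have "ptr x = x" unfolding ptr_def by (rule if_not_P)
        then show ?thesis using xy that E_irrefl unfolding kept_edge_def by simp
      qed
      ultimately show ?thesis using proper[OF xy] unfolding tolerates_def by blast
    qed
    have "legal c v p"
      unfolding legal_def
    proof (intro impI conjI allI)
      assume "c = 2"
      then have nt: "\<not> in_triangle v" and deg: "\<not> degree_ge3 v" using h2 v by auto
      show "\<not> in_triangle v" by (fact nt)
      \<comment> \<open>A deleted neighbour would put \<open>v\<close> into a triangle.\<close>
      have keep: "kept_edge v x" if "E v x" for x
      proof -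
        have "\<not> deleted x"
          using nt deleted_neighbour[of x v] that E_sym triangle_perm(1) unfolding in_triangle_def by metis
        then show ?thesis using that v unfolding kept_edge_def by blast
      qed
      fix x y assume xy: "E v x \<and> E v y \<and> x \<noteq> p \<and> y \<noteq> p"
      have c: "h z = 1" if "E v z" "z \<noteq> p" for z
      proof -
        have "tolerates 2 p z (h z)" using tol[OF keep[OF that(1)]] v \<open>c = 2\<close> by simp
        then have "h z \<noteq> 2" "h z \<noteq> 0" using that unfolding tolerates_def by auto
        then show ?thesis using hr[of z] kept_less[OF keep[OF that(1)]] by auto
      qed
      show "x = y" using uniq[OF keep keep, of x y] xy c v \<open>c = 2\<close> by auto
    qed
    moreover have "\<exists>d q. (d, w, q) \<in> A \<and> tolerates c p w d \<and> tolerates d q v c" if "kept_edge v w" for w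
    proof (intro exI conjI)
      show "(h w, w, ptr w) \<in> A" using that kept_less unfolding A_def kept_edge_def by blast
    qed (use tol[OF that] tol[OF kept_edge_sym[OF that]] v in auto)
    ultimately show "supported A c v p" unfolding supported_def by blast
  qed
  ultimately show ?thesis by blast
qed

text \<open>Among undeleted vertices \<open>E\<close> and \<open>kept_edge\<close> agree, so
  chordality leaves only triangles, and every triangle has lost a corner.\<close>

lemma kept_acyclic:
  assumes chordal: "\<And>xs. set xs \<subseteq> {..<n} \<Longrightarrow> induced_cycle_rel E xs \<Longrightarrow> length xs \<le> 3"
    and ok: "triangles_ok" and sub: "set xs \<subseteq> {v. v < n \<and> \<not> deleted v}"
  shows "\<not> induced_cycle_rel kept_edge xs"
proof
  assume c: "induced_cycle_rel kept_edge xs"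
  have "kept_edge (xs ! i) (xs ! j) \<longleftrightarrow> E (xs ! i) (xs ! j)" if "i < length xs" "j < length xs" for i j
    using sub nth_mem[OF that(1)] nth_mem[OF that(2)] unfolding kept_edge_def by auto
  then have cE: "induced_cycle_rel E xs" using c unfolding induced_cycle_rel_def by metis
  moreover have "set xs \<subseteq> {..<n}" using sub by auto
  ultimately have "length xs = 3" using chordal c unfolding induced_cycle_rel_def by fastforce
  then have "triangle (xs ! 0) (xs ! 1) (xs ! 2)"
    using cE unfolding induced_cycle_rel_def triangle_def by auto
  then have "\<exists>i<3. deleted (xs ! i)" using triangle_has_deleted[OF ok]
    by (metis less_numeral_extra(1) numeral_2_eq_2 numeral_3_eq_3 less_Suc_eq One_nat_def)
  then show False using sub \<open>length xs = 3\<close> by (metis (no_types, lifting) mem_Collect_eq nth_mem subset_iff)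
qed

lemma arc_consistent_imp_colouring:
  assumes chordal: "\<And>xs. set xs \<subseteq> {..<n} \<Longrightarrow> induced_cycle_rel E xs \<Longrightarrow> length xs \<le> 3"
    and ok: "triangles_ok" and A: "A \<subseteq> states" "arc_consistent A" "covers A"
  shows "\<exists>f. rs_colouring_rel {..<n} E f"
proof -
  define V where "V = {v. v < n \<and> \<not> deleted v}"
  define C where "C = (\<lambda>v s w t. tolerates (fst s) (snd s) w (fst t) \<and> tolerates (fst t) (snd t) v (fst s))"
  have "\<exists>g. \<forall>v\<in>V. g v \<in> {(c, p). (c, v, p) \<in> A} \<and> (\<forall>w\<in>V. kept_edge v w \<longrightarrow> C v (g v) w (g w))"
  proof (rule arc_consistent_forest_solvable)
    show "finite V" unfolding V_def by simp
    show "\<And>x y. kept_edge x y \<Longrightarrow> kept_edge y x" by (rule kept_edge_sym)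
    show "\<And>x. \<not> kept_edge x x" using E_irrefl unfolding kept_edge_def by blast
    show "\<And>xs. set xs \<subseteq> V \<Longrightarrow> \<not> induced_cycle_rel kept_edge xs"
      using kept_acyclic[OF chordal ok] unfolding V_def by blast
    show "\<And>v. v \<in> V \<Longrightarrow> {(c, p). (c, v, p) \<in> A} \<noteq> {}" using A(3) unfolding covers_def V_def by auto
    fix v w s
    assume "kept_edge v w" "s \<in> {(c, p). (c, v, p) \<in> A}"
    then show "\<exists>t\<in>{(c, p). (c, w, p) \<in> A}. C v s w t"
    proof -
      obtain c p where s: "s = (c, p)" "(c, v, p) \<in> A"
        using \<open>s \<in> {(c, p). (c, v, p) \<in> A}\<close> by auto
      then have "supported A c v p" using A(2) unfolding arc_consistent_def by blast
      then obtain d q where "(d, w, q) \<in> A" "tolerates c p w d" "tolerates d q v c"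
        using \<open>kept_edge v w\<close> unfolding supported_def by blast
      then show ?thesis unfolding C_def s by auto
    qed
  next
    show "\<And>v s w t. C v s w t \<Longrightarrow> C w t v s" unfolding C_def by blast
  qed
  then obtain g where g': "\<forall>v\<in>V. g v \<in> {(c, p). (c, v, p) \<in> A} \<and>
    (\<forall>w\<in>V. kept_edge v w \<longrightarrow> C v (g v) w (g w))" ..
  then have gC: "C v (g v) w (g w)" if "kept_edge v w" "v \<in> V" "w \<in> V" for v w
    using that by simp
  have g: "(fst (g v), v, snd (g v)) \<in> A" if "v \<in> V" for v
    using g' that by (auto simp: case_prod_beta)
  define f where "f = (\<lambda>v. if deleted v then 2 else fst (g v))"
  have fV: "f v < 3" if "v < n" for v
    using g[of v] A(1) that unfolding f_def V_def states_def by auto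
  have kV: "v \<in> V" "w \<in> V" if "kept_edge v w" for v w
    using that E_less E_sym unfolding kept_edge_def V_def by auto
  have tol: "tolerates (f v) (snd (g v)) w (f w)" if "kept_edge v w" for v w
    using gC[OF that kV[OF that]] that unfolding C_def f_def kept_edge_def by auto
  have legal: "legal (f v) v (snd (g v))" if "v < n" "\<not> deleted v" for v
    using g[of v] A(2) that unfolding f_def V_def arc_consistent_def supported_def by auto
  have f2: "\<not> in_triangle v" if "f v = 2" "v < n" "\<not> deleted v" for v
    using legal that unfolding legal_def by blast
  have proper_kept: "f v \<noteq> f w" if "kept_edge v w" for v w
    using tol[OF that] unfolding tolerates_def by blast
  have del: "\<not> deleted a \<and> f a \<noteq> 2" if "deleted c" "E c a" for c a
  proof -
    obtain b where b: "triangle c a b" using deleted_neighbour \<open>deleted c\<close> \<open>E c a\<close> by blast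
    then have "\<not> deleted a" "in_triangle a"
      using deletedD \<open>deleted c\<close> triangle_perm(1) unfolding in_triangle_def by blast+
    then show ?thesis using f2 E_less[OF E_sym[OF \<open>E c a\<close>]] by blast
  qed
  have fdel: "f c = 2" if "deleted c" for c using that unfolding f_def by simp
  have proper: "f x \<noteq> f y" if "E x y" for x y
    using that proper_kept del fdel E_sym unfolding kept_edge_def by metis
  have "False" if xyz: "E x y" "E y z" "x \<noteq> z" "f x < f y" "f x = f z" for x y z
  proof -
    have "f y < 3" using fV E_less xyz(2) by blast
    \<comment> \<open>The ends have a colour below that of \<open>y\<close>, hence not 2.\<close>
    then have nd: "\<not> deleted x" "\<not> deleted z" using fdel xyz by fastforce+
    show False
    proof (cases "deleted y")
      \<comment> \<open>The ends are the two other corners of the triangle at \<open>y\<close>, so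
        they are adjacent and differ in colour.\<close>
      case True
      obtain b where b: "triangle y x b" using deleted_neighbour True E_sym xyz(1) by blast
      then have "z = b" using low_degreeD[of y x b z] True xyz unfolding deleted_def by blast
      then have "E x z" using b unfolding triangle_def by blast
      then show False using proper xyz by blast
    next
      case False
      then have k: "kept_edge y x" "kept_edge y z"
        using xyz nd E_sym unfolding kept_edge_def by auto
      show False
      proof (cases "f x = 0")
        case True
        \<comment> \<open>Both ends would be the pointer of \<open>y\<close>.\<close>
        then show False using tol[OF k(1)] tol[OF k(2)] xyz unfolding tolerates_def by auto
      next
        case ne: False
        then have c: "f y = 2" "f x = 1" "f z = 1" using \<open>f y < 3\<close> xyz by auto
        \<comment> \<open>A pointer among the neighbours of \<open>y\<close> has colour 0, so
          neither end is the pointer, and \<open>legal\<close> admits only one such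
          neighbour.\<close>
        then have "x \<noteq> snd (g y)" "z \<noteq> snd (g y)"
          using tol[OF k(1)] tol[OF k(2)] unfolding tolerates_def by auto
        then show False using legal[OF E_less[OF xyz(2)] False] c xyz E_sym[OF xyz(1)]
          unfolding legal_def by blast
      qed
    qed
  qed
  moreover have "f ` {..<n} \<subseteq> {0, 1, 2}" using fV by fastforce
  ultimately have "rs_colouring_rel {..<n} E f"
    using proper unfolding rs_colouring_rel_def by blast
  then show ?thesis by blast
qed

lemma colourable_iff_arc_consistent:
  assumes "\<And>xs. set xs \<subseteq> {..<n} \<Longrightarrow> induced_cycle_rel E xs \<Longrightarrow> length xs \<le> 3"
  shows "(\<exists>f. rs_colouring_rel {..<n} E f) \<longleftrightarrow>
    triangles_ok \<and> (\<exists>A\<subseteq>states. arc_consistent A \<and> covers A)"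
  using colouring_triangles_ok colouring_imp_arc_consistent
    arc_consistent_imp_colouring[OF assms] by blast

end

section \<open>Evaluating first-order formulas in polynomial time\<close>

definition runs :: "com \<Rightarrow> store \<Rightarrow> nat \<Rightarrow> (store \<Rightarrow> bool) \<Rightarrow> bool" where
  "runs c s T Q \<longleftrightarrow> (\<exists>t s'. exec c s t s' \<and> t \<le> T \<and> Q s')"

definition upd :: "store \<Rightarrow> nat \<Rightarrow> nat \<Rightarrow> nat \<Rightarrow> store" where
  "upd s a i v = s(a := (s a)(i := v))"

lemma upd_apply: "upd s a i v b j = (if b = a \<and> j = i then v else s b j)"
  by (simp add: upd_def)

lemma runs_mono: "runs c s T Q \<Longrightarrow> T \<le> T' \<Longrightarrow> (\<And>s'. Q s' \<Longrightarrow> Q' s') \<Longrightarrow> runs c s T' Q'"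
  unfolding runs_def by (meson le_trans)

lemma runs_Skip: "Q s \<Longrightarrow> runs Skip s 1 Q"
  unfolding runs_def using exec_Skip by blast

lemma runs_Assign: "Q (upd s a (aval i s) (aval e s)) \<Longrightarrow> runs (Assign a i e) s 1 Q"
  unfolding runs_def upd_def using exec_Assign by blast

lemma runs_Seq:
  assumes "runs c1 s T1 P" "\<And>s'. P s' \<Longrightarrow> runs c2 s' T2 Q"
  shows "runs (Seq c1 c2) s (T1 + T2) Q"
proof -
  obtain t1 s1 where 1: "exec c1 s t1 s1" "t1 \<le> T1" "P s1" using assms(1) unfolding runs_def by blast
  then obtain t2 s2 where 2: "exec c2 s1 t2 s2" "t2 \<le> T2" "Q s2" using assms(2) unfolding runs_def by blast
  show ?thesis unfolding runs_def using exec_Seq[OF 1(1) 2(1)] 1 2 by (meson add_mono)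
qed

lemma runs_Cond:
  assumes "bval b s \<Longrightarrow> runs c1 s T Q" "\<not> bval b s \<Longrightarrow> runs c2 s T Q"
  shows "runs (Cond b c1 c2) s (1 + T) Q"
  using assms exec_Cond_True exec_Cond_False unfolding runs_def by (metis add_le_cancel_left)

text \<open>The induction is on the number \<open>k\<close> of iterations still to come. Each
  iteration pays one unit for its test; the last unit is the failing test.\<close>

lemma runs_While:
  assumes step: "\<And>x s. x < m \<Longrightarrow> J x s \<Longrightarrow> bval b s \<and> runs c s T (J (Suc x))"
    and stop: "\<And>s. J m s \<Longrightarrow> \<not> bval b s" and "J 0 s"
  shows "runs (While b c) s (m * (T + 1) + 1) (J m)"
proof -
  have "runs (While b c) s (k * (T + 1) + 1) (J m)" if "J (m - k) s" "k \<le> m" for k s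
    using that
  proof (induction k arbitrary: s)
    case 0
    then show ?case unfolding runs_def using exec_While_False stop by fastforce
  next
    case (Suc k)
    have "m - Suc k < m" and eq: "Suc (m - Suc k) = m - k" using Suc.prems(2) by auto
    then have b: "bval b s" and "runs c s T (J (m - k))" using step Suc.prems(1) by metis+
    then obtain t1 s1 where 1: "exec c s t1 s1" "t1 \<le> T" "J (m - k) s1" unfolding runs_def by blast
    then obtain t2 s2 where 2: "exec (While b c) s1 t2 s2" "t2 \<le> k * (T + 1) + 1" "J m s2"
      using Suc.IH[of s1] Suc.prems(2) unfolding runs_def by auto
    have "exec (While b c) s (1 + t1 + t2) s2" by (rule exec_While_True[OF b 1(1) 2(1)])
    moreover have "1 + t1 + t2 \<le> Suc k * (T + 1) + 1" using 1(2) 2(2) by simp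
    ultimately show ?case unfolding runs_def using 2(3) by blast
  qed
  from this[of m] show ?thesis using \<open>J 0 s\<close> by simp
qed

text \<open>Loop variables and quantified variables live in array 3, loop bounds in array 2.\<close>

abbreviation Var :: "nat \<Rightarrow> aexp" where
  "Var k \<equiv> Cell 3 (Const k)"

definition For :: "nat \<Rightarrow> nat \<Rightarrow> com \<Rightarrow> com" where
  "For k b c = Seq (Assign 3 (Const k) (Const 0))
     (While (Less (Var k) (Cell 2 (Const b))) (Seq c (Assign 3 (Const k) (Plus (Var k) (Const 1)))))"

text \<open>An iteration costs the body, a test and an increment; the final 2 pays for initialising
  the counter and for the failing test. The body may overwrite the counter if it restores
  it.\<close>

lemma runs_For:
  assumes step: "\<And>x s. x < m \<Longrightarrow> I x s \<Longrightarrow> s 3 k = x \<Longrightarrow> s 2 b = m \<Longrightarrow>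
      runs c s T (\<lambda>s'. I (Suc x) s' \<and> s' 3 k = x \<and> s' 2 b = m)"
    and ins: "\<And>x s v. I x s \<Longrightarrow> I x (upd s 3 k v)"
    and "I 0 s" "s 2 b = m"
  shows "runs (For k b c) s (m * (T + 2) + 2) (\<lambda>s'. I m s' \<and> s' 2 b = m)"
proof -
  define J where "J = (\<lambda>x s. I x s \<and> s 3 k = x \<and> s 2 b = m)"
  have "runs (For k b c) s (1 + (m * (T + 1 + 1) + 1)) (J m)"
    unfolding For_def
  proof (rule runs_Seq[where P = "J 0"], rule runs_Assign)
    show "J 0 (upd s 3 (aval (Const k) s) (aval (Const 0) s))"
      using assms(3,4) ins by (simp add: J_def upd_apply)
    fix s assume "J 0 s"
    then show "runs (While (Less (Var k) (Cell 2 (Const b))) (Seq c (Assign 3 (Const k) (Plus (Var k) (Const 1)))))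
       s (m * (T + 1 + 1) + 1) (J m)"
    proof (rule runs_While[where J = J and m = m, rotated 2])
      fix x s assume x: "x < m" "J x s"
      have "runs (Seq c (Assign 3 (Const k) (Plus (Var k) (Const 1)))) s (T + 1) (J (Suc x))"
      proof (rule runs_Seq)
        show "runs c s T (\<lambda>s'. I (Suc x) s' \<and> s' 3 k = x \<and> s' 2 b = m)"
          using step x by (simp add: J_def)
        fix s' assume "I (Suc x) s' \<and> s' 3 k = x \<and> s' 2 b = m"
        then show "runs (Assign 3 (Const k) (Plus (Var k) (Const 1))) s' 1 (J (Suc x))"
          by (intro runs_Assign) (simp add: J_def ins upd_apply)
      qed
      then show "bval (Less (Var k) (Cell 2 (Const b))) s \<and>
        runs (Seq c (Assign 3 (Const k) (Plus (Var k) (Const 1)))) s (T + 1) (J (Suc x))"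
        using x by (simp add: J_def)
    qed (simp add: J_def)
  qed
  then show ?thesis by (rule runs_mono) (auto simp: J_def)
qed

section \<open>First-order formulas over the vertices and their compilation\<close>

datatype fm = Atom bexp | FNot fm | FAnd fm fm | FEx nat fm

fun sat :: "fm \<Rightarrow> store \<Rightarrow> bool" where
  "sat (Atom b) s \<longleftrightarrow> bval b s"
| "sat (FNot \<phi>) s \<longleftrightarrow> \<not> sat \<phi> s"
| "sat (FAnd \<phi> \<psi>) s \<longleftrightarrow> sat \<phi> s \<and> sat \<psi> s"
| "sat (FEx k \<phi>) s \<longleftrightarrow> (\<exists>x<s 2 0. sat \<phi> (upd s 3 k x))"

text \<open>Array 4 is the evaluation stack of compiled formulas, so the atoms must not read it.\<close>

fun a_stackfree :: "aexp \<Rightarrow> bool" where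
  "a_stackfree (Const n) \<longleftrightarrow> True"
| "a_stackfree (Cell a e) \<longleftrightarrow> a \<noteq> 4 \<and> a_stackfree e"
| "a_stackfree (Plus e1 e2) \<longleftrightarrow> a_stackfree e1 \<and> a_stackfree e2"
| "a_stackfree (Monus e1 e2) \<longleftrightarrow> a_stackfree e1 \<and> a_stackfree e2"

fun b_stackfree :: "bexp \<Rightarrow> bool" where
  "b_stackfree (Less e1 e2) \<longleftrightarrow> a_stackfree e1 \<and> a_stackfree e2"
| "b_stackfree (Neg b) \<longleftrightarrow> b_stackfree b"
| "b_stackfree (Conj b1 b2) \<longleftrightarrow> b_stackfree b1 \<and> b_stackfree b2"

fun stackfree :: "fm \<Rightarrow> bool" where
  "stackfree (Atom b) \<longleftrightarrow> b_stackfree b"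
| "stackfree (FNot \<phi>) \<longleftrightarrow> stackfree \<phi>"
| "stackfree (FAnd \<phi> \<psi>) \<longleftrightarrow> stackfree \<phi> \<and> stackfree \<psi>"
| "stackfree (FEx k \<phi>) \<longleftrightarrow> stackfree \<phi>"

lemma aval_stackfree: "a_stackfree e \<Longrightarrow> (\<And>a. a \<noteq> 4 \<Longrightarrow> s a = s' a) \<Longrightarrow> aval e s = aval e s'"
  by (induction e) auto

lemma bval_stackfree: "b_stackfree b \<Longrightarrow> (\<And>a. a \<noteq> 4 \<Longrightarrow> s a = s' a) \<Longrightarrow> bval b s = bval b s'"
  by (induction b) (auto simp: aval_stackfree[of _ s s'])

lemma sat_stackfree: "stackfree \<phi> \<Longrightarrow> (\<And>a. a \<noteq> 4 \<Longrightarrow> s a = s' a) \<Longrightarrow> sat \<phi> s = sat \<phi> s'"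
proof (induction \<phi> arbitrary: s s')
  case (FEx k \<phi>)
  have "sat \<phi> (upd s 3 k x) = sat \<phi> (upd s' 3 k x)" for x
    using FEx.prems by (intro FEx.IH) (auto simp: upd_def)
  then show ?case using FEx.prems(2)[of 2] by simp
next
  case (FAnd \<phi> \<psi>)
  have "sat \<phi> s = sat \<phi> s'" "sat \<psi> s = sat \<psi> s'"
    by (rule FAnd.IH; use FAnd.prems in simp)+
  then show ?case by simp
next
  case (FNot \<phi>)
  have "sat \<phi> s = sat \<phi> s'" by (rule FNot.IH; use FNot.prems in simp)
  then show ?case by simp
next
  case (Atom b)
  then show ?case using bval_stackfree[of b s s'] by simp
qed

text \<open>The truth value is left in stack cell \<open>d\<close>, and the cells below stay intact.
  A quantifier saves the old value of its variable in cell \<open>Suc d\<close> and restores it, so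
  evaluation has no effect outside the stack and formulas can be tested inside loops over the same
  variables.\<close>

fun compile :: "nat \<Rightarrow> fm \<Rightarrow> com" where
  "compile d (Atom b) = Cond b (Assign 4 (Const d) (Const 1)) (Assign 4 (Const d) (Const 0))"
| "compile d (FNot \<phi>) = Seq (compile d \<phi>)
     (Assign 4 (Const d) (Monus (Const 1) (Cell 4 (Const d))))"
| "compile d (FAnd \<phi> \<psi>) = Seq (compile d \<phi>) (Seq (compile (Suc d) \<psi>)
     (Cond (Less (Const 0) (Cell 4 (Const d)))
       (Assign 4 (Const d) (Cell 4 (Const (Suc d)))) Skip))"
| "compile d (FEx k \<phi>) = Seq (Assign 4 (Const (Suc d)) (Var k))
     (Seq (Assign 4 (Const d) (Const 0))
     (Seq (For k 0 (Seq (compile (Suc (Suc d)) \<phi>)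
        (Cond (Less (Const 0) (Cell 4 (Const (Suc (Suc d))))) (Assign 4 (Const d) (Const 1)) Skip)))
     (Assign 3 (Const k) (Cell 4 (Const (Suc d))))))"

fun fm_time :: "fm \<Rightarrow> nat \<Rightarrow> nat" where
  "fm_time (Atom b) n = 2"
| "fm_time (FNot \<phi>) n = fm_time \<phi> n + 1"
| "fm_time (FAnd \<phi> \<psi>) n = fm_time \<phi> n + (fm_time \<psi> n + 2)"
| "fm_time (FEx k \<phi>) n = n * (fm_time \<phi> n + 4) + 5"

lemma runs_compile:
  assumes "stackfree \<phi>" "s 2 0 = n"
  shows "runs (compile d \<phi>) s (fm_time \<phi> n) (\<lambda>s'. (\<forall>a. a \<noteq> 4 \<longrightarrow> s' a = s a) \<and>
    (\<forall>i<d. s' 4 i = s 4 i) \<and> s' 4 d = of_bool (sat \<phi> s))"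
  using assms
proof (induction \<phi> arbitrary: d s)
  case (Atom b)
  have "runs (compile d (Atom b)) s (1 + 1) (\<lambda>s'. (\<forall>a. a \<noteq> 4 \<longrightarrow> s' a = s a) \<and>
    (\<forall>i<d. s' 4 i = s 4 i) \<and> s' 4 d = of_bool (sat (Atom b) s))"
    unfolding compile.simps
    by (intro runs_Cond runs_Assign) (auto simp: upd_def)
  then show ?case unfolding fm_time.simps by (rule runs_mono) simp_all
next
  case (FNot \<phi>)
  show ?case unfolding compile.simps fm_time.simps
  proof (rule runs_Seq[OF FNot.IH])
    show "stackfree \<phi>" "s 2 0 = n" using FNot.prems by simp_all
  qed (rule runs_Assign, auto simp: upd_def)
next
  case (FAnd \<phi> \<psi>)
  define P where "P = (\<lambda>s'. (\<forall>a. a \<noteq> 4 \<longrightarrow> s' a = s a) \<and> (\<forall>i<d. s' 4 i = s 4 i) \<and>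
    s' 4 d = of_bool (sat \<phi> s))"
  define Q where "Q = (\<lambda>s'. P s' \<and> s' 4 (Suc d) = of_bool (sat \<psi> s))"
  show ?case unfolding compile.simps fm_time.simps
  proof (rule runs_Seq[where P = P])
    show "runs (compile d \<phi>) s (fm_time \<phi> n) P" using FAnd.IH(1) FAnd.prems by (simp add: P_def)
    fix s1 assume s1: "P s1"
    show "runs (Seq (compile (Suc d) \<psi>) (Cond (Less (Const 0) (Cell 4 (Const d)))
       (Assign 4 (Const d) (Cell 4 (Const (Suc d)))) Skip)) s1 (fm_time \<psi> n + 2)
       (\<lambda>s'. (\<forall>a. a \<noteq> 4 \<longrightarrow> s' a = s a) \<and>
         (\<forall>i<d. s' 4 i = s 4 i) \<and> s' 4 d = of_bool (sat (FAnd \<phi> \<psi>) s))"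
    proof (rule runs_Seq[where P = Q])
      \<comment> \<open>By now the value of \<open>\<phi>\<close> is on the stack, which
        \<open>\<psi>\<close> does not read.\<close>
      have "sat \<psi> s1 = sat \<psi> s" using FAnd.prems s1 by (intro sat_stackfree) (auto simp: P_def)
      then show "runs (compile (Suc d) \<psi>) s1 (fm_time \<psi> n) Q"
        using FAnd.prems s1 by (intro runs_mono[OF FAnd.IH(2) order_refl]) (auto simp: P_def Q_def)
      fix s2 assume "Q s2"
      then have "runs (Cond (Less (Const 0) (Cell 4 (Const d)))
       (Assign 4 (Const d) (Cell 4 (Const (Suc d)))) Skip) s2 (1 + 1)
       (\<lambda>s'. (\<forall>a. a \<noteq> 4 \<longrightarrow> s' a = s a) \<and>
         (\<forall>i<d. s' 4 i = s 4 i) \<and> s' 4 d = of_bool (sat (FAnd \<phi> \<psi>) s))"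
        by (intro runs_Cond runs_Assign runs_Skip) (auto simp: upd_def P_def Q_def)
      then show "runs (Cond (Less (Const 0) (Cell 4 (Const d)))
       (Assign 4 (Const d) (Cell 4 (Const (Suc d)))) Skip) s2 2
       (\<lambda>s'. (\<forall>a. a \<noteq> 4 \<longrightarrow> s' a = s a) \<and>
         (\<forall>i<d. s' 4 i = s 4 i) \<and> s' 4 d = of_bool (sat (FAnd \<phi> \<psi>) s))"
        by (rule runs_mono) simp_all
    qed
  qed
next
  case (FEx k \<phi>)
  define I where "I = (\<lambda>x s'. (\<forall>a. a \<noteq> 3 \<and> a \<noteq> 4 \<longrightarrow> s' a = s a) \<and>
    (\<forall>j. j \<noteq> k \<longrightarrow> s' 3 j = s 3 j) \<and> (\<forall>i<d. s' 4 i = s 4 i) \<and>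
    s' 4 d = of_bool (\<exists>y<x. sat \<phi> (upd s 3 k y)) \<and> s' 4 (Suc d) = s 3 k)"
  define body where "body = Seq (compile (Suc (Suc d)) \<phi>)
    (Cond (Less (Const 0) (Cell 4 (Const (Suc (Suc d))))) (Assign 4 (Const d) (Const 1)) Skip)"
  have loop: "runs (For k 0 body) s1 (n * (fm_time \<phi> n + (1 + 1) + 2) + 2)
     (\<lambda>s'. I n s' \<and> s' 2 0 = n)" if "I 0 s1" for s1
  proof (rule runs_For)
    show "I 0 s1" by (fact that)
    then show "s1 2 0 = n" using FEx.prems by (simp add: I_def)
    show "I x (upd s 3 k v)" if "I x s" for x s v
      using that by (auto simp: I_def upd_def)
    fix x s2 assume x: "x < n" "I x s2" "s2 3 k = x" "s2 2 0 = n"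
    \<comment> \<open>Outside the stack, the store inside the loop differs from \<open>s\<close>
      only in the bound variable.\<close>
    have s2: "s2 a = upd s 3 k x a" if "a \<noteq> 4" for a
      using x that by (cases "a = 3") (auto simp: I_def upd_def)
    have sat: "sat \<phi> s2 = sat \<phi> (upd s 3 k x)"
      using FEx.prems s2 by (intro sat_stackfree) auto
    show "runs body s2 (fm_time \<phi> n + (1 + 1)) (\<lambda>s'. I (Suc x) s' \<and> s' 3 k = x \<and> s' 2 0 = n)"
      unfolding body_def
    proof (rule runs_Seq[OF FEx.IH])
      fix s3 assume s3: "(\<forall>a. a \<noteq> 4 \<longrightarrow> s3 a = s2 a) \<and> (\<forall>i<Suc (Suc d). s3 4 i = s2 4 i) \<and>
        s3 4 (Suc (Suc d)) = of_bool (sat \<phi> s2)"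
      have I3: "I x s3" "s3 3 k = x" "s3 2 0 = n" using s3 x by (auto simp: I_def)
      show "runs (Cond (Less (Const 0) (Cell 4 (Const (Suc (Suc d))))) (Assign 4 (Const d) (Const 1)) Skip)
        s3 (1 + 1) (\<lambda>s'. I (Suc x) s' \<and> s' 3 k = x \<and> s' 2 0 = n)"
      proof (intro runs_Cond runs_Assign runs_Skip)
        assume "bval (Less (Const 0) (Cell 4 (Const (Suc (Suc d))))) s3"
        then have "sat \<phi> (upd s 3 k x)" using s3 sat by simp
        then show "I (Suc x) (upd s3 4 (aval (Const d) s3) (aval (Const 1) s3)) \<and>
          upd s3 4 (aval (Const d) s3) (aval (Const 1) s3) 3 k = x \<and>
          upd s3 4 (aval (Const d) s3) (aval (Const 1) s3) 2 0 = n"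
          using I3 by (auto simp: I_def upd_def)
      next
        assume "\<not> bval (Less (Const 0) (Cell 4 (Const (Suc (Suc d))))) s3"
        then have "\<not> sat \<phi> (upd s 3 k x)" using s3 sat by simp
        then show "I (Suc x) s3 \<and> s3 3 k = x \<and> s3 2 0 = n"
          using I3 by (auto simp: I_def less_Suc_eq)
      qed
    qed (use FEx.prems x in auto)
  qed
  have "runs (compile d (FEx k \<phi>)) s (1 + (1 + (n * (fm_time \<phi> n + (1 + 1) + 2) + 2 + 1)))
    (\<lambda>s'. (\<forall>a. a \<noteq> 4 \<longrightarrow> s' a = s a) \<and> (\<forall>i<d. s' 4 i = s 4 i) \<and> s' 4 d = of_bool (sat (FEx k \<phi>) s))"
    unfolding compile.simps body_def[symmetric]
  proof (rule runs_Seq[where P = "\<lambda>s'. s' = upd s 4 (Suc d) (s 3 k)"])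
    show "runs (Assign 4 (Const (Suc d)) (Var k)) s 1 (\<lambda>s'. s' = upd s 4 (Suc d) (s 3 k))"
      by (rule runs_Assign) simp
    fix s1 assume s1: "s1 = upd s 4 (Suc d) (s 3 k)"
    show "runs (Seq (Assign 4 (Const d) (Const 0)) (Seq (For k 0 body) (Assign 3 (Const k) (Cell 4 (Const (Suc d))))))
      s1 (1 + (n * (fm_time \<phi> n + (1 + 1) + 2) + 2 + 1))
      (\<lambda>s'. (\<forall>a. a \<noteq> 4 \<longrightarrow> s' a = s a) \<and> (\<forall>i<d. s' 4 i = s 4 i) \<and> s' 4 d = of_bool (sat (FEx k \<phi>) s))"
    proof (rule runs_Seq[where P = "I 0"], rule runs_Assign)
      show "I 0 (upd s1 4 (aval (Const d) s1) (aval (Const 0) s1))"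
        unfolding s1 by (auto simp: I_def upd_def)
      fix s2 assume "I 0 s2"
      then show "runs (Seq (For k 0 body) (Assign 3 (Const k) (Cell 4 (Const (Suc d))))) s2
        (n * (fm_time \<phi> n + (1 + 1) + 2) + 2 + 1)
        (\<lambda>s'. (\<forall>a. a \<noteq> 4 \<longrightarrow> s' a = s a) \<and> (\<forall>i<d. s' 4 i = s 4 i) \<and> s' 4 d = of_bool (sat (FEx k \<phi>) s))"
      proof (rule runs_Seq[OF loop], intro runs_Assign)
        fix s3 assume s3: "I n s3 \<and> s3 2 0 = n"
        let ?s = "upd s3 3 (aval (Const k) s3) (aval (Cell 4 (Const (Suc d))) s3)"
        have "?s a = s a" if "a \<noteq> 4" for a
          using s3 that by (cases "a = 3") (auto simp: I_def upd_def)
        moreover have "?s 4 i = s 4 i" if "i < d" for i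
          using s3 that by (simp add: I_def upd_def)
        moreover have "?s 4 d = of_bool (sat (FEx k \<phi>) s)"
          using s3 FEx.prems by (simp add: I_def upd_def)
        ultimately show "(\<forall>a. a \<noteq> 4 \<longrightarrow> ?s a = s a) \<and> (\<forall>i<d. ?s 4 i = s 4 i) \<and>
            ?s 4 d = of_bool (sat (FEx k \<phi>) s)" by blast
      qed
    qed
  qed
  then show ?case by (rule runs_mono) (auto simp: algebra_simps)
qed

section \<open>Polynomial bounds on running times\<close>

definition poly_bounded :: "(nat \<Rightarrow> nat) \<Rightarrow> bool" where
  "poly_bounded f \<longleftrightarrow> (\<exists>p :: nat poly. \<forall>n. f n \<le> poly p n)"

lemma poly_bounded_const: "poly_bounded (\<lambda>n. c)"
  unfolding poly_bounded_def by (rule exI[of _ "[:c:]"]) simp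

lemma poly_bounded_id: "poly_bounded (\<lambda>n. n)"
  unfolding poly_bounded_def by (rule exI[of _ "[:0, 1:]"]) simp

lemma poly_bounded_add: "poly_bounded f \<Longrightarrow> poly_bounded g \<Longrightarrow> poly_bounded (\<lambda>n. f n + g n)"
  unfolding poly_bounded_def by (metis add_mono poly_add)

lemma poly_bounded_mult: "poly_bounded f \<Longrightarrow> poly_bounded g \<Longrightarrow> poly_bounded (\<lambda>n. f n * g n)"
  unfolding poly_bounded_def by (metis mult_le_mono poly_mult)

lemmas poly_bounded_intros =
  poly_bounded_const poly_bounded_id poly_bounded_add poly_bounded_mult

lemma poly_bounded_fm_time: "poly_bounded (fm_time \<phi>)"
proof (induction \<phi>)
  case (Atom b)
  then show ?case using poly_bounded_const[of 2] by (simp add: poly_bounded_def)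
next
  case (FNot \<phi>)
  from poly_bounded_add[OF this poly_bounded_const[of 1]] show ?case by (simp add: poly_bounded_def)
next
  case (FAnd \<phi> \<psi>)
  have "poly_bounded (\<lambda>n. fm_time \<phi> n + (fm_time \<psi> n + 2))"
    by (intro poly_bounded_intros FAnd)
  then show ?case by (simp add: poly_bounded_def)
next
  case (FEx k \<phi>)
  have "poly_bounded (\<lambda>n. n * (fm_time \<phi> n + 4) + 5)"
    by (intro poly_bounded_intros FEx)
  then show ?case by (simp add: poly_bounded_def)
qed

text \<open>The coefficients are natural numbers, hence nonnegative.\<close>

lemma poly_nat_mono: "x \<le> y \<Longrightarrow> poly p x \<le> poly p y" for p :: "nat poly"
  by (induction p) (auto intro: add_mono mult_le_mono)

section \<open>The decision procedure\<close>

definition FOr :: "fm \<Rightarrow> fm \<Rightarrow> fm" where "FOr \<phi> \<psi> = FNot (FAnd (FNot \<phi>) (FNot \<psi>))"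
definition FImp :: "fm \<Rightarrow> fm \<Rightarrow> fm" where "FImp \<phi> \<psi> = FNot (FAnd \<phi> (FNot \<psi>))"
definition FAll :: "nat \<Rightarrow> fm \<Rightarrow> fm" where "FAll k \<phi> = FNot (FEx k (FNot \<phi>))"
definition FBool :: "bool \<Rightarrow> fm" where "FBool b = Atom (Less (Const 0) (Const (of_bool b)))"
definition FLess :: "nat \<Rightarrow> nat \<Rightarrow> fm" where "FLess x y = Atom (Less (Var x) (Var y))"
definition FEq :: "nat \<Rightarrow> nat \<Rightarrow> fm" where "FEq x y = FAnd (FNot (FLess x y)) (FNot (FLess y x))"

lemma sat_derived [simp]:
  "sat (FOr \<phi> \<psi>) s \<longleftrightarrow> sat \<phi> s \<or> sat \<psi> s"
  "sat (FImp \<phi> \<psi>) s \<longleftrightarrow> (sat \<phi> s \<longrightarrow> sat \<psi> s)"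
  "sat (FAll k \<phi>) s \<longleftrightarrow> (\<forall>x<s 2 0. sat \<phi> (upd s 3 k x))"
  "sat (FBool b) s \<longleftrightarrow> b"
  "sat (FLess x y) s \<longleftrightarrow> s 3 x < s 3 y"
  "sat (FEq x y) s \<longleftrightarrow> s 3 x = s 3 y"
  by (auto simp: FOr_def FImp_def FAll_def FBool_def FLess_def FEq_def)

lemma stackfree_derived [simp]:
  "stackfree (FOr \<phi> \<psi>) \<longleftrightarrow> stackfree \<phi> \<and> stackfree \<psi>"
  "stackfree (FImp \<phi> \<psi>) \<longleftrightarrow> stackfree \<phi> \<and> stackfree \<psi>"
  "stackfree (FAll k \<phi>) \<longleftrightarrow> stackfree \<phi>"
  "stackfree (FBool b)" "stackfree (FLess x y)" "stackfree (FEq x y)"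
  by (auto simp: FOr_def FImp_def FAll_def FBool_def FLess_def FEq_def)

text \<open>The machine cannot multiply: array 5 holds the row offsets \<open>i * n\<close>. Array \<open>10 + c\<close> marks
  the discarded states of colour \<open>c\<close>, so the all-zero store represents the full set of states.
  The predicates on vertices bind variables from 10 on, so arguments below 10 are never captured.\<close>

definition f_adj :: "nat \<Rightarrow> nat \<Rightarrow> fm" where
  "f_adj x y = Atom (Less (Const 0) (Cell 0 (Plus (Cell 5 (Var x)) (Var y))))"

definition f_alive :: "nat \<Rightarrow> nat \<Rightarrow> nat \<Rightarrow> fm" where
  "f_alive c x p = FNot (Atom (Less (Const 0) (Cell (10 + c) (Plus (Cell 5 (Var x)) (Var p)))))"

definition f_triangle :: "nat \<Rightarrow> nat \<Rightarrow> nat \<Rightarrow> fm" where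
  "f_triangle a b c = FAnd (f_adj a b) (FAnd (f_adj b c) (f_adj a c))"

definition f_degree_ge3 :: "nat \<Rightarrow> fm" where
  "f_degree_ge3 v = FEx 10 (FEx 11 (FEx 12 (FAnd (FAnd (f_adj v 10) (FAnd (f_adj v 11) (f_adj v 12)))
     (FAnd (FNot (FEq 10 11)) (FAnd (FNot (FEq 11 12)) (FNot (FEq 10 12)))))))"

definition f_in_triangle :: "nat \<Rightarrow> fm" where
  "f_in_triangle v = FEx 13 (FEx 14 (f_triangle v 13 14))"

definition f_deleted :: "nat \<Rightarrow> fm" where
  "f_deleted v = FAnd (FNot (f_degree_ge3 v)) (FEx 15 (FEx 16 (FAnd (f_triangle v 15 16)
     (FAnd (FOr (f_degree_ge3 15) (FLess v 15)) (FOr (f_degree_ge3 16) (FLess v 16))))))"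

definition f_kept_edge :: "nat \<Rightarrow> nat \<Rightarrow> fm" where
  "f_kept_edge v w = FAnd (f_adj v w) (FAnd (FNot (f_deleted v)) (FNot (f_deleted w)))"

definition f_legal :: "nat \<Rightarrow> nat \<Rightarrow> nat \<Rightarrow> fm" where
  "f_legal c v p = FImp (FBool (c = 2)) (FAnd (FNot (f_in_triangle v))
     (FAll 17 (FAll 18 (FImp (FAnd (FAnd (f_adj v 17) (f_adj v 18))
        (FAnd (FNot (FEq 17 p)) (FNot (FEq 18 p)))) (FEq 17 18)))))"

definition f_tolerates :: "nat \<Rightarrow> nat \<Rightarrow> nat \<Rightarrow> nat \<Rightarrow> fm" where
  "f_tolerates c p w d = FAnd (FBool (c \<noteq> d)) (FAnd (FImp (FBool (c \<noteq> 0 \<and> d = 0)) (FEq w p))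
     (FImp (FBool (c = 2 \<and> d \<noteq> 0)) (FNot (FEq w p))))"

text \<open>The tested state has its vertex in variable 0 and its pointer in variable 1; variables 2
  and 3 run over the neighbours and their pointers. Colours are fixed when the formula is written
  and are not values of variables, so the choice of a supporting colour becomes a threefold
  disjunction.\<close>

definition f_supported :: "nat \<Rightarrow> fm" where
  "f_supported c = FAnd (f_legal c 0 1) (FAll 2 (FImp (f_kept_edge 0 2)
     (let g = (\<lambda>d. FAnd (f_alive d 2 3) (FAnd (f_tolerates c 1 2 d) (f_tolerates d 3 0 c)))
      in FEx 3 (FOr (g 0) (FOr (g 1) (g 2))))))"

definition f_triangles_ok :: fm where
  "f_triangles_ok = FAll 0 (FAll 1 (FAll 2 (FImp (f_triangle 0 1 2)
     (FNot (FAnd (f_degree_ge3 0) (FAnd (f_degree_ge3 1) (f_degree_ge3 2)))))))"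

definition f_covers :: fm where
  "f_covers = FAll 0 (FOr (f_deleted 0)
     (FEx 1 (FOr (f_alive 0 0 1) (FOr (f_alive 1 0 1) (f_alive 2 0 1)))))"

definition f_answer :: fm where
  "f_answer = FAnd f_triangles_ok f_covers"

lemmas f_defs = f_adj_def f_alive_def f_triangle_def f_degree_ge3_def f_in_triangle_def f_deleted_def
  f_kept_edge_def f_legal_def f_tolerates_def f_supported_def f_triangles_ok_def f_covers_def
  f_answer_def

lemma stackfree_f_supported: "c < 3 \<Longrightarrow> stackfree (f_supported c)"
  by (simp add: f_defs Let_def)

lemma stackfree_f_answer: "stackfree f_answer"
  by (simp add: f_defs)

section \<open>The programs and their running times\<close>

definition prog_discard :: "nat \<Rightarrow> com" where
  "prog_discard c = Seq (compile 0 (f_supported c)) (Cond (Less (Const 0) (Cell 4 (Const 0))) Skip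
     (Assign (10 + c) (Plus (Cell 5 (Var 0)) (Var 1)) (Const 1)))"

definition prog_round :: com where
  "prog_round = For 0 0 (For 1 0 (Seq (prog_discard 0) (Seq (prog_discard 1) (prog_discard 2))))"

text \<open>The input supplies only the word length \<open>n * n\<close>. Cell 0 counts
  \<open>x\<close> upwards while cell 2 follows its square by
  \<open>(x + 1) * (x + 1) = x * x + x + x + 1\<close>, until the square reaches the length.\<close>

definition prog_size :: com where
  "prog_size = While (Less (Cell 2 (Const 2)) (Cell 1 (Const 0)))
     (Seq (Assign 2 (Const 2) (Plus (Plus (Cell 2 (Const 2)) (Cell 2 (Const 0))) (Plus (Cell 2 (Const 0)) (Const 1))))
       (Assign 2 (Const 0) (Plus (Cell 2 (Const 0)) (Const 1))))"

definition prog_rows :: com where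
  "prog_rows = For 0 0 (Assign 5 (Plus (Var 0) (Const 1)) (Plus (Cell 5 (Var 0)) (Cell 2 (Const 0))))"

text \<open>The number of rounds is three times the word length, that is, the number of states. Cell
  30 serves as their counter because neither the formulas nor the loops of a round use it.\<close>

definition prog_rs3 :: com where
  "prog_rs3 = Seq prog_size
     (Seq (Assign 2 (Const 1) (Plus (Cell 1 (Const 0)) (Plus (Cell 1 (Const 0)) (Cell 1 (Const 0)))))
     (Seq prog_rows (Seq (For 30 1 prog_round)
     (Seq (compile 0 f_answer) (Assign 1 (Const 0) (Cell 4 (Const 0)))))))"

definition discard_time :: "nat \<Rightarrow> nat" where
  "discard_time n = fm_time (f_supported 0) n + fm_time (f_supported 1) n + fm_time (f_supported 2) n + 2"

definition round_time :: "nat \<Rightarrow> nat" where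
  "round_time n = n * (n * (discard_time n + (discard_time n + discard_time n) + 2) + 2 + 2) + 2"

text \<open>The sums follow the nesting of \<open>prog_rs3\<close>, so that \<open>runs_Seq\<close>
  applies as it stands.\<close>

definition total_time :: "nat \<Rightarrow> nat" where
  "total_time n = (n * (1 + 1 + 1) + 1) + (1 + ((n * (1 + 2) + 2) +
     ((3 * n * n * (round_time n + 2) + 2) + (fm_time f_answer n + 1))))"

lemma poly_bounded_total_time: "poly_bounded total_time"
  unfolding total_time_def round_time_def discard_time_def
  by (intro poly_bounded_intros poly_bounded_fm_time)

text \<open>Division by \<open>n\<close> recovers the row. Hence marking one state touches no
  other.\<close>

lemma row_index_inject:
  fixes n :: nat
  assumes "p < n" "q < n"
  shows "v * n + p = w * n + q \<longleftrightarrow> v = w \<and> p = q"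
proof
  assume eq: "v * n + p = w * n + q"
  have "(v * n + p) div n = v" "(w * n + q) div n = w" using assms by simp_all
  then show "v = w \<and> p = q" using eq by auto
qed simp

context indexed_graph
begin

section \<open>Correctness of the formulas\<close>

definition represents :: "store \<Rightarrow> bool" where
  "represents s \<longleftrightarrow> s 2 0 = n \<and> s 2 1 = 3 * n * n \<and> (\<forall>i<n. s 5 i = i * n) \<and>
     (\<forall>i<n. \<forall>j<n. s 0 (i * n + j) \<noteq> 0 \<longleftrightarrow> E i j)"

definition alive :: "store \<Rightarrow> (nat \<times> nat \<times> nat) set" where
  "alive s = {(c, v, p). c < 3 \<and> v < n \<and> p < n \<and> s (10 + c) (v * n + p) = 0}"

lemma alive_states: "alive s \<subseteq> states"
  by (auto simp: alive_def states_def)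

lemma represents_upd [simp]: "represents (upd s 3 k v) \<longleftrightarrow> represents s"
  by (simp add: represents_def upd_def)

lemma alive_upd [simp]: "alive (upd s 3 k v) = alive s"
  by (simp add: alive_def upd_def)

lemma upd_simps [simp]: "upd s 3 k v 3 j = (if j = k then v else s 3 j)" "upd s 3 k v 2 j = s 2 j"
  by (simp_all add: upd_def)

lemma E_less2: "E x y \<Longrightarrow> y < n"
  using E_less E_sym by blast

lemma represents_size: "represents s \<Longrightarrow> s 2 0 = n"
  by (simp add: represents_def)

lemma sat_f_adj: "represents s \<Longrightarrow> s 3 x < n \<Longrightarrow> s 3 y < n \<Longrightarrow> sat (f_adj x y) s \<longleftrightarrow> E (s 3 x) (s 3 y)"
  by (simp add: f_adj_def represents_def)

lemma sat_f_alive: "represents s \<Longrightarrow> c < 3 \<Longrightarrow> s 3 x < n \<Longrightarrow> s 3 p < n \<Longrightarrow>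
    sat (f_alive c x p) s \<longleftrightarrow> (c, s 3 x, s 3 p) \<in> alive s"
  by (simp add: f_alive_def represents_def alive_def)

lemma sat_f_triangle: "represents s \<Longrightarrow> s 3 a < n \<Longrightarrow> s 3 b < n \<Longrightarrow> s 3 c < n \<Longrightarrow>
    sat (f_triangle a b c) s \<longleftrightarrow> triangle (s 3 a) (s 3 b) (s 3 c)"
  by (simp add: f_triangle_def triangle_def sat_f_adj)

text \<open>Bounding the quantifiers by \<open>n\<close> loses nothing, as edges join only indices
  below \<open>n\<close>. Only the bound variables are excluded for \<open>v\<close>, because
  \<open>f_deleted\<close> also uses the formula at 15 and 16.\<close>

lemma sat_f_degree_ge3: "represents s \<Longrightarrow> s 3 v < n \<Longrightarrow> v \<notin> {10, 11, 12} \<Longrightarrow>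
    sat (f_degree_ge3 v) s \<longleftrightarrow> degree_ge3 (s 3 v)"
  by (simp add: f_degree_ge3_def degree_ge3_def sat_f_adj represents_size cong: conj_cong)
    (metis E_less2)

lemma sat_f_in_triangle: "represents s \<Longrightarrow> s 3 v < n \<Longrightarrow> v \<notin> {13, 14} \<Longrightarrow>
    sat (f_in_triangle v) s \<longleftrightarrow> in_triangle (s 3 v)"
  by (simp add: f_in_triangle_def in_triangle_def sat_f_triangle represents_size cong: conj_cong)
    (metis E_less2 triangle_def)

lemma sat_f_deleted: "represents s \<Longrightarrow> s 3 v < n \<Longrightarrow> v < 10 \<Longrightarrow>
    sat (f_deleted v) s \<longleftrightarrow> deleted (s 3 v)"
  by (simp add: f_deleted_def deleted_def sat_f_triangle sat_f_degree_ge3 represents_size cong: conj_cong)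
    (metis E_less2 triangle_def)

lemma sat_f_kept_edge: "represents s \<Longrightarrow> s 3 v < n \<Longrightarrow> s 3 w < n \<Longrightarrow> v < 10 \<Longrightarrow> w < 10 \<Longrightarrow>
    sat (f_kept_edge v w) s \<longleftrightarrow> kept_edge (s 3 v) (s 3 w)"
  by (simp add: f_kept_edge_def kept_edge_def sat_f_adj sat_f_deleted)

lemma sat_f_legal: "represents s \<Longrightarrow> s 3 v < n \<Longrightarrow> s 3 p < n \<Longrightarrow> v < 10 \<Longrightarrow> p < 10 \<Longrightarrow>
    sat (f_legal c v p) s \<longleftrightarrow> legal c (s 3 v) (s 3 p)"
  by (simp add: f_legal_def legal_def sat_f_adj sat_f_in_triangle represents_size cong: imp_cong)
    (metis E_less2)

lemma sat_f_tolerates: "sat (f_tolerates c p w d) s \<longleftrightarrow> tolerates c (s 3 p) (s 3 w) d"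
  by (auto simp: f_tolerates_def tolerates_def)

lemma sat_f_supported:
  assumes s: "represents s" "s 3 0 < n" "s 3 1 < n" and "c < 3"
  shows "sat (f_supported c) s \<longleftrightarrow> supported (alive s) c (s 3 0) (s 3 1)"
proof -
  \<comment> \<open>Colours in \<open>alive s\<close> are below 3, which turns the quantifier over
    \<open>d\<close> into the disjunction in the formula.\<close>
  have 3: "(\<exists>d q. (d, w, q) \<in> alive s \<and> P d q) \<longleftrightarrow> (\<exists>q<n. (0, w, q) \<in> alive s \<and> P 0 q \<or>
     (1, w, q) \<in> alive s \<and> P 1 q \<or> (2, w, q) \<in> alive s \<and> P 2 q)" (is "?L \<longleftrightarrow> ?R") for w P
  proof
    assume ?L
    then obtain d q where "(d, w, q) \<in> alive s" "P d q" by blast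
    moreover have "d = 0 \<or> d = 1 \<or> d = 2" "q < n" using calculation(1) by (auto simp: alive_def)
    ultimately show ?R by blast
  qed blast
  have kept: "kept_edge v w \<Longrightarrow> w < n" for v w using E_less2 by (auto simp: kept_edge_def)
  show ?thesis
    using s unfolding f_supported_def supported_def Let_def 3
    by (simp add: sat_f_legal sat_f_kept_edge sat_f_alive sat_f_tolerates represents_size cong: imp_cong conj_cong)
      (use kept in blast)
qed

lemma sat_f_answer:
  assumes s: "represents s"
  shows "sat f_answer s \<longleftrightarrow> triangles_ok \<and> covers (alive s)"
proof -
  have "sat f_triangles_ok s \<longleftrightarrow> triangles_ok"
    using s unfolding f_triangles_ok_def triangles_ok_def
    by (simp add: sat_f_triangle sat_f_degree_ge3 represents_size cong: imp_cong)
      (metis E_less E_less2 triangle_def)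
  moreover have "(\<exists>c p. (c, v, p) \<in> alive s) \<longleftrightarrow>
      (\<exists>p<n. (0, v, p) \<in> alive s \<or> (1, v, p) \<in> alive s \<or> (2, v, p) \<in> alive s)" (is "?L \<longleftrightarrow> ?R") for v
  proof
    assume ?L
    then obtain c p where "(c, v, p) \<in> alive s" by blast
    moreover have "c = 0 \<or> c = 1 \<or> c = 2" "p < n" using calculation(1) by (auto simp: alive_def)
    ultimately show ?R by blast
  qed blast
  then have "sat f_covers s \<longleftrightarrow> covers (alive s)"
    using s unfolding f_covers_def covers_def
    by (simp add: sat_f_deleted sat_f_alive represents_size cong: imp_cong conj_cong)
  ultimately show ?thesis by (simp add: f_answer_def)
qed

section \<open>Rounds of discarding and the largest arc consistent set\<close>

text \<open>Discarding happens in place, so the set of states changes in the middle of a round. If it is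
  the same after the round as before, then all checks of the round were made against this set.\<close>

definition sweep_inv :: "(nat \<times> nat \<times> nat) set \<Rightarrow> (nat \<times> nat \<times> nat) set \<Rightarrow> store \<Rightarrow> bool" where
  "sweep_inv A0 D s \<longleftrightarrow> represents s \<and> alive s \<subseteq> A0 \<and>
     (\<forall>A\<subseteq>A0. arc_consistent A \<longrightarrow> A \<subseteq> alive s) \<and>
     (alive s = A0 \<longrightarrow> (\<forall>c v p. (c, v, p) \<in> D \<inter> A0 \<longrightarrow> supported A0 c v p))"

text \<open>Consequently a state without support in the current set has none in any subset, so
  discarding it takes nothing from an arc consistent set.\<close>

lemma supported_mono: "supported A c v p \<Longrightarrow> A \<subseteq> B \<Longrightarrow> supported B c v p"
  unfolding supported_def by blast

lemma sweep_inv_upd [simp]: "sweep_inv A0 D (upd s 3 k x) \<longleftrightarrow> sweep_inv A0 D s"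
  by (simp add: sweep_inv_def)

lemma alive_discard:
  assumes "c < 3" "v < n" "p < n"
  shows "alive (upd s (10 + c) (v * n + p) 1) = alive s - {(c, v, p)}"
  using assms by (auto simp: alive_def upd_def row_index_inject split: if_splits)

lemma runs_discard:
  assumes inv: "sweep_inv A0 D s" and c: "c < 3" and vars: "s 3 0 < n" "s 3 1 < n"
  shows "runs (prog_discard c) s (discard_time n)
     (\<lambda>s'. sweep_inv A0 (insert (c, s 3 0, s 3 1) D) s' \<and> s' 3 = s 3 \<and> s' 2 = s 2)"
proof -
  let ?t = "(c, s 3 0, s 3 1)"
  have rep: "represents s" using inv by (simp add: sweep_inv_def)
  have "runs (prog_discard c) s (fm_time (f_supported c) n + (1 + 1))
     (\<lambda>s'. sweep_inv A0 (insert ?t D) s' \<and> s' 3 = s 3 \<and> s' 2 = s 2)"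
    unfolding prog_discard_def
  proof (rule runs_Seq[OF runs_compile])
    show "stackfree (f_supported c)" using c by (rule stackfree_f_supported)
    show "s 2 0 = n" using rep by (rule represents_size)
    fix s1 assume s1: "(\<forall>a. a \<noteq> 4 \<longrightarrow> s1 a = s a) \<and> (\<forall>i<0. s1 4 i = s 4 i) \<and>
      s1 4 0 = of_bool (sat (f_supported c) s)"
    have same: "represents s1" "alive s1 = alive s" using s1 rep by (simp_all add: represents_def alive_def)
    then have inv1: "sweep_inv A0 D s1" using inv by (simp add: sweep_inv_def)
    show "runs (Cond (Less (Const 0) (Cell 4 (Const 0))) Skip
     (Assign (10 + c) (Plus (Cell 5 (Var 0)) (Var 1)) (Const 1))) s1 (1 + 1)
      (\<lambda>s'. sweep_inv A0 (insert ?t D) s' \<and> s' 3 = s 3 \<and> s' 2 = s 2)"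
    proof (intro runs_Cond runs_Skip runs_Assign)
      assume "bval (Less (Const 0) (Cell 4 (Const 0))) s1"
      then have "supported (alive s) c (s 3 0) (s 3 1)"
        using s1 sat_f_supported[OF rep vars c] by simp
      then have "sweep_inv A0 (insert ?t D) s1"
        using inv1 same unfolding sweep_inv_def by auto
      then show "sweep_inv A0 (insert ?t D) s1 \<and> s1 3 = s 3 \<and> s1 2 = s 2" using s1 by simp
    next
      assume "\<not> bval (Less (Const 0) (Cell 4 (Const 0))) s1"
      then have unsup: "\<not> supported (alive s) c (s 3 0) (s 3 1)"
        using s1 sat_f_supported[OF rep vars c] by simp
      let ?s = "upd s1 (10 + c) (aval (Plus (Cell 5 (Var 0)) (Var 1)) s1) (aval (Const 1) s1)"
      have "?s = upd s1 (10 + c) (s 3 0 * n + s 3 1) 1"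
        using s1 rep vars by (simp add: represents_def)
      then have al: "alive ?s = alive s - {?t}" using alive_discard[OF c vars] same by simp
      have rep': "represents ?s" using same by (simp add: represents_def upd_def)
      have "A \<subseteq> alive ?s" if A: "A \<subseteq> A0" "arc_consistent A" for A
      proof -
        have "A \<subseteq> alive s" using A inv unfolding sweep_inv_def by blast
        moreover have "?t \<notin> A"
          using A unsup supported_mono[OF _ calculation] unfolding arc_consistent_def by blast
        ultimately show ?thesis using al by blast
      qed
      moreover have "\<forall>c v p. (c, v, p) \<in> insert ?t D \<inter> A0 \<longrightarrow> supported A0 c v p" if "alive ?s = A0"
      proof -
        \<comment> \<open>If the set equals \<open>A0\<close> after the removal of
          \<open>?t\<close>, then \<open>?t\<close> was never in \<open>A0\<close> and there is
          nothing to check for it.\<close>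
        have "?t \<notin> A0" "alive s = A0" using that al inv unfolding sweep_inv_def by blast+
        then show ?thesis using inv unfolding sweep_inv_def by auto
      qed
      moreover have "alive ?s \<subseteq> A0" using al inv unfolding sweep_inv_def by blast
      ultimately have "sweep_inv A0 (insert ?t D) ?s" using rep' unfolding sweep_inv_def by blast
      then show "sweep_inv A0 (insert ?t D) ?s \<and> ?s 3 = s 3 \<and> ?s 2 = s 2"
        using s1 by (simp add: upd_def)
    qed
  qed
  moreover have "fm_time (f_supported c) n + (1 + 1) \<le> discard_time n"
  proof -
    have "c = 0 \<or> c = 1 \<or> c = 2" using c by auto
    then show ?thesis unfolding discard_time_def by auto
  qed
  ultimately show ?thesis by (rule runs_mono)
qed

lemma sweep_inv_subset: "sweep_inv A0 D s \<Longrightarrow> D' \<subseteq> D \<Longrightarrow> sweep_inv A0 D' s"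
  unfolding sweep_inv_def by blast

lemma runs_discard_all:
  assumes inv: "sweep_inv A0 D s" and vars: "s 3 0 < n" "s 3 1 < n"
  shows "runs (Seq (prog_discard 0) (Seq (prog_discard 1) (prog_discard 2))) s
     (discard_time n + (discard_time n + discard_time n))
     (\<lambda>s'. sweep_inv A0 ({..<3} \<times> {s 3 0} \<times> {s 3 1} \<union> D) s' \<and> s' 3 = s 3 \<and> s' 2 = s 2)"
proof (rule runs_Seq[OF runs_discard[OF inv _ vars]])
  fix s1 assume 1: "sweep_inv A0 (insert (0, s 3 0, s 3 1) D) s1 \<and> s1 3 = s 3 \<and> s1 2 = s 2"
  show "runs (Seq (prog_discard 1) (prog_discard 2)) s1 (discard_time n + discard_time n)
     (\<lambda>s'. sweep_inv A0 ({..<3} \<times> {s 3 0} \<times> {s 3 1} \<union> D) s' \<and> s' 3 = s 3 \<and> s' 2 = s 2)"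
  proof (rule runs_Seq[OF runs_discard])
    fix s2 assume 2: "sweep_inv A0 (insert (1, s1 3 0, s1 3 1) (insert (0, s 3 0, s 3 1) D)) s2 \<and>
      s2 3 = s1 3 \<and> s2 2 = s1 2"
    show "runs (prog_discard 2) s2 (discard_time n)
     (\<lambda>s'. sweep_inv A0 ({..<3} \<times> {s 3 0} \<times> {s 3 1} \<union> D) s' \<and> s' 3 = s 3 \<and> s' 2 = s 2)"
    proof (rule runs_mono[OF runs_discard order_refl])
      fix s3 assume 3: "sweep_inv A0 (insert (2, s2 3 0, s2 3 1) (insert (1, s1 3 0, s1 3 1)
        (insert (0, s 3 0, s 3 1) D))) s3 \<and> s3 3 = s2 3 \<and> s3 2 = s2 2"
      have "{..<3::nat} = {0, 1, 2}" by auto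
      then show "sweep_inv A0 ({..<3} \<times> {s 3 0} \<times> {s 3 1} \<union> D) s3 \<and> s3 3 = s 3 \<and> s3 2 = s 2"
        using 1 2 3 by (auto elim!: sweep_inv_subset)
    qed (use 1 2 vars in auto)
  qed (use 1 vars in auto)
qed simp

lemma runs_round:
  assumes "represents s"
  shows "runs prog_round s (round_time n)
     (\<lambda>s'. sweep_inv (alive s) states s' \<and> s' 3 30 = s 3 30)"
proof -
  define I where "I = (\<lambda>x s'. sweep_inv (alive s) ({..<3} \<times> {..<x} \<times> {..<n}) s' \<and> s' 3 30 = s 3 30)"
  define J where "J = (\<lambda>x y s'. sweep_inv (alive s) ({..<3} \<times> ({..<x} \<times> {..<n} \<union> {x} \<times> {..<y})) s' \<and>
    s' 3 0 = x \<and> s' 3 30 = s 3 30)"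
  have size: "s' 2 0 = n" if "sweep_inv A D s'" for A D s'
    using that represents_size unfolding sweep_inv_def by blast
  have "runs prog_round s (round_time n) (\<lambda>s'. I n s' \<and> s' 2 0 = n)"
    unfolding prog_round_def round_time_def
  proof (rule runs_For[where I = I])
    show "I 0 s" using assms by (simp add: I_def sweep_inv_def)
    show "s 2 0 = n" using assms by (rule represents_size)
    show "I x (upd s 3 0 v)" if "I x s" for x s v using that by (simp add: I_def)
    fix x s1 assume x: "x < n" "I x s1" "s1 3 0 = x"
    have "runs (For 1 0 (Seq (prog_discard 0) (Seq (prog_discard 1) (prog_discard 2)))) s1
      (n * (discard_time n + (discard_time n + discard_time n) + 2) + 2) (\<lambda>s'. J x n s' \<and> s' 2 0 = n)"
    proof (rule runs_For[where I = "J x"])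
      show "J x 0 s1" using x by (simp add: J_def I_def)
      show "s1 2 0 = n" using x size by (auto simp: I_def)
      show "J x y (upd s 3 1 v)" if "J x y s" for y s v using that by (simp add: J_def)
      fix y s2 assume y: "y < n" "J x y s2" "s2 3 1 = y" "s2 2 0 = n"
      have D: "{..<3::nat} \<times> {x} \<times> {y} \<union> {..<3} \<times> ({..<x} \<times> {..<n} \<union> {x} \<times> {..<y}) =
        {..<3} \<times> ({..<x} \<times> {..<n} \<union> {x} \<times> {..<Suc y})" by auto
      show "runs (Seq (prog_discard 0) (Seq (prog_discard 1) (prog_discard 2))) s2
        (discard_time n + (discard_time n + discard_time n))
        (\<lambda>s'. J x (Suc y) s' \<and> s' 3 1 = y \<and> s' 2 0 = n)"
      proof (rule runs_mono[OF runs_discard_all order_refl])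
        show "sweep_inv (alive s) ({..<3} \<times> ({..<x} \<times> {..<n} \<union> {x} \<times> {..<y})) s2"
          "s2 3 0 < n" "s2 3 1 < n" using x y by (simp_all add: J_def)
        fix s' assume "sweep_inv (alive s) ({..<3} \<times> {s2 3 0} \<times> {s2 3 1} \<union>
          {..<3} \<times> ({..<x} \<times> {..<n} \<union> {x} \<times> {..<y})) s' \<and> s' 3 = s2 3 \<and> s' 2 = s2 2"
        then have "sweep_inv (alive s) ({..<3} \<times> ({..<x} \<times> {..<n} \<union> {x} \<times> {..<Suc y})) s'"
          and "s' 3 = s2 3" "s' 2 = s2 2" using x y unfolding D[symmetric] J_def by simp_all
        then show "J x (Suc y) s' \<and> s' 3 1 = y \<and> s' 2 0 = n"
          using y by (simp add: J_def)
      qed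
    qed
    moreover have "{..<3::nat} \<times> ({..<x} \<times> {..<n} \<union> {x} \<times> {..<n}) = {..<3} \<times> {..<Suc x} \<times> {..<n}" by auto
    ultimately show "runs (For 1 0 (Seq (prog_discard 0) (Seq (prog_discard 1) (prog_discard 2)))) s1
      (n * (discard_time n + (discard_time n + discard_time n) + 2) + 2)
      (\<lambda>s'. I (Suc x) s' \<and> s' 3 0 = x \<and> s' 2 0 = n)"
      by (elim runs_mono) (simp_all add: I_def J_def)
  qed
  then show ?thesis by (rule runs_mono) (simp_all add: I_def states_def)
qed

lemma sweep_card:
  assumes "sweep_inv (alive s) states s'"
  shows "arc_consistent (alive s') \<or> card (alive s') < card (alive s)"
proof (cases "alive s' = alive s")
  case True
  have "\<forall>c v p. (c, v, p) \<in> states \<inter> alive s \<longrightarrow> supported (alive s) c v p"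
    using assms True unfolding sweep_inv_def by blast
  then have "arc_consistent (alive s)"
    using alive_states unfolding arc_consistent_def by blast
  then show ?thesis using True by simp
next
  case False
  moreover have "alive s' \<subseteq> alive s" using assms unfolding sweep_inv_def by blast
  moreover have "finite (alive s)"
    by (rule finite_subset[OF alive_states]) (simp add: states_def)
  ultimately show ?thesis by (meson psubsetI psubset_card_mono)
qed

text \<open>Until arc consistency is reached, each round removes a state. So after
  \<open>3 * n * n\<close> rounds the set is arc consistent or empty, and the empty set is arc
  consistent as well.\<close>

definition rounds_inv :: "nat \<Rightarrow> store \<Rightarrow> bool" where
  "rounds_inv r s \<longleftrightarrow> represents s \<and> (\<forall>A\<subseteq>states. arc_consistent A \<longrightarrow> A \<subseteq> alive s) \<and>
     (arc_consistent (alive s) \<or> card (alive s) + r \<le> 3 * n * n)"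

lemma rounds_inv_step:
  assumes r: "rounds_inv r s" and s': "sweep_inv (alive s) states s'"
  shows "rounds_inv (Suc r) s'"
proof -
  have sub: "alive s' \<subseteq> alive s" using s' unfolding sweep_inv_def by blast
  have all: "A \<subseteq> alive s'" if "A \<subseteq> states" "arc_consistent A" for A
  proof -
    have "A \<subseteq> alive s" using that r unfolding rounds_inv_def by simp
    then show ?thesis using that(2) s' unfolding sweep_inv_def by simp
  qed
  have "arc_consistent (alive s')" if "arc_consistent (alive s)"
  proof -
    \<comment> \<open>\<open>alive s\<close> is itself one of the arc consistent sets that a round
      leaves intact.\<close>
    have "alive s = alive s'" using all[OF alive_states that] sub by blast
    then show ?thesis using that by simp
  qed
  then have "arc_consistent (alive s') \<or> card (alive s') + Suc r \<le> 3 * n * n"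
    using sweep_card[OF s'] r unfolding rounds_inv_def by linarith
  then show ?thesis using all s' unfolding rounds_inv_def sweep_inv_def by blast
qed

text \<open>The final set is arc consistent and contains every arc consistent set of states. As
  \<open>covers\<close> is monotone, testing this one set decides whether any set passes.\<close>

lemma runs_rounds:
  assumes s: "represents s" "alive s = states"
  shows "runs (For 30 1 prog_round) s (3 * n * n * (round_time n + 2) + 2)
     (\<lambda>s'. represents s' \<and> (covers (alive s') \<longleftrightarrow> (\<exists>A\<subseteq>states. arc_consistent A \<and> covers A)))"
proof (rule runs_mono[OF runs_For[where I = rounds_inv] order_refl])
  show "rounds_inv 0 s" using s by (simp add: rounds_inv_def states_def card_cartesian_product)
  show "s 2 1 = 3 * n * n" using s by (simp add: represents_def)
  show "rounds_inv x (upd s 3 30 v)" if "rounds_inv x s" for x s v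
    using that by (simp add: rounds_inv_def)
  show "runs prog_round s (round_time n) (\<lambda>s'. rounds_inv (Suc x) s' \<and> s' 3 30 = x \<and> s' 2 1 = 3 * n * n)"
    if x: "rounds_inv x s" "s 3 30 = x" for x s
  proof (rule runs_mono[OF runs_round order_refl])
    show "represents s" using x by (simp add: rounds_inv_def)
    fix s' assume s': "sweep_inv (alive s) states s' \<and> s' 3 30 = s 3 30"
    then show "rounds_inv (Suc x) s' \<and> s' 3 30 = x \<and> s' 2 1 = 3 * n * n"
      using rounds_inv_step x by (auto simp: sweep_inv_def represents_def)
  qed
  fix s' assume "rounds_inv (3 * n * n) s' \<and> s' 2 1 = 3 * n * n"
  then have inv: "rounds_inv (3 * n * n) s'" by blast
  then have "arc_consistent (alive s') \<or> card (alive s') = 0" by (auto simp: rounds_inv_def)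
  moreover have "finite (alive s')"
    by (rule finite_subset[OF alive_states]) (simp add: states_def)
  ultimately have "arc_consistent (alive s')" by (auto simp: arc_consistent_def)
  moreover have "covers (alive s')" if "A \<subseteq> states" "arc_consistent A" "covers A" for A
  proof -
    have "A \<subseteq> alive s'" using that inv unfolding rounds_inv_def by simp
    then show ?thesis using that(3) unfolding covers_def by blast
  qed
  ultimately show "represents s' \<and> (covers (alive s') \<longleftrightarrow> (\<exists>A\<subseteq>states. arc_consistent A \<and> covers A))"
    using inv alive_states[of s'] unfolding rounds_inv_def by blast
qed

section \<open>Initialisation and the whole program\<close>

lemma runs_size:
  assumes "s 1 0 = n * n" "s 2 0 = 0" "s 2 2 = 0"
  shows "runs prog_size s (n * (1 + 1 + 1) + 1) (\<lambda>s'. s' 2 0 = n \<and> (\<forall>a. a \<noteq> 2 \<longrightarrow> s' a = s a))"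
proof -
  define J where "J = (\<lambda>x s'. s' 2 0 = x \<and> s' 2 2 = x * x \<and> (\<forall>a. a \<noteq> 2 \<longrightarrow> s' a = s a))"
  have "runs prog_size s (n * (1 + 1 + 1) + 1) (J n)"
    unfolding prog_size_def
  proof (rule runs_While)
    show "J 0 s" using assms by (simp add: J_def)
    show "\<And>s. J n s \<Longrightarrow> \<not> bval (Less (Cell 2 (Const 2)) (Cell 1 (Const 0))) s"
      using assms by (simp add: J_def)
    fix x s1 assume x: "x < n" "J x s1"
    have "x * x < n * n" using x(1) by (simp add: mult_strict_mono)
    then show "bval (Less (Cell 2 (Const 2)) (Cell 1 (Const 0))) s1 \<and>
      runs (Seq (Assign 2 (Const 2) (Plus (Plus (Cell 2 (Const 2)) (Cell 2 (Const 0))) (Plus (Cell 2 (Const 0)) (Const 1))))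
       (Assign 2 (Const 0) (Plus (Cell 2 (Const 0)) (Const 1)))) s1 (1 + 1) (J (Suc x))"
    proof (intro conjI runs_Seq[where P = "\<lambda>s'. s' 2 0 = x \<and> s' 2 2 = Suc x * Suc x \<and> (\<forall>a. a \<noteq> 2 \<longrightarrow> s' a = s a)"]
        runs_Assign)
    qed (use x assms in \<open>auto simp: J_def upd_def\<close>)
  qed
  then show ?thesis by (rule runs_mono) (simp_all add: J_def)
qed

lemma runs_rows:
  assumes "s 2 0 = n" "s 5 0 = 0"
  shows "runs prog_rows s (n * (1 + 2) + 2)
    (\<lambda>s'. (\<forall>i<n. s' 5 i = i * n) \<and> (\<forall>a. a \<noteq> 3 \<and> a \<noteq> 5 \<longrightarrow> s' a = s a))"
proof -
  \<comment> \<open>Each iteration writes the offset of the next row, so after \<open>x\<close>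
    iterations the entries up to and including \<open>x\<close> are right.\<close>
  define I where "I = (\<lambda>x s'. (\<forall>i\<le>x. s' 5 i = i * n) \<and> (\<forall>a. a \<noteq> 3 \<and> a \<noteq> 5 \<longrightarrow> s' a = s a))"
  have "runs prog_rows s (n * (1 + 2) + 2) (\<lambda>s'. I n s' \<and> s' 2 0 = n)"
    unfolding prog_rows_def
  proof (rule runs_For[where I = I])
    show "I 0 s" using assms by (simp add: I_def)
    show "s 2 0 = n" by fact
    show "I x (upd s 3 0 v)" if "I x s" for x s v using that by (simp add: I_def upd_def)
    show "runs (Assign 5 (Plus (Var 0) (Const 1)) (Plus (Cell 5 (Var 0)) (Cell 2 (Const 0)))) s 1
      (\<lambda>s'. I (Suc x) s' \<and> s' 3 0 = x \<and> s' 2 0 = n)"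
      if "I x s" "s 3 0 = x" "s 2 0 = n" for x s
      by (rule runs_Assign) (use that in \<open>auto simp: I_def upd_def le_Suc_eq\<close>)
  qed
  then show ?thesis by (rule runs_mono) (simp_all add: I_def)
qed

lemma runs_prog_rs3:
  assumes len: "length w = n * n" and w: "\<And>i j. i < n \<Longrightarrow> j < n \<Longrightarrow> w ! (i * n + j) \<longleftrightarrow> E i j"
  shows "runs prog_rs3 (initial_store w) (total_time n)
    (\<lambda>s'. s' 1 0 \<noteq> 0 \<longleftrightarrow> triangles_ok \<and> (\<exists>A\<subseteq>states. arc_consistent A \<and> covers A))"
proof -
  let ?s = "initial_store w"
  let ?Q = "\<lambda>s'. s' 1 0 \<noteq> 0 \<longleftrightarrow> triangles_ok \<and> (\<exists>A\<subseteq>states. arc_consistent A \<and> covers A)"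
  have idx: "i * n + j < n * n" if "i < n" "j < n" for i j
  proof -
    have "i * n + j < Suc i * n" using that by simp
    also have "\<dots> \<le> n * n" using that by (intro mult_le_mono1) simp
    finally show ?thesis .
  qed
  have word: "?s 0 (i * n + j) \<noteq> 0 \<longleftrightarrow> E i j" if "i < n" "j < n" for i j
    using idx[OF that] w[OF that] len by (simp add: initial_store_def)
  show ?thesis
    unfolding prog_rs3_def total_time_def
  proof (rule runs_Seq[OF runs_size])
    show "?s 1 0 = n * n" "?s 2 0 = 0" "?s 2 2 = 0" using len by (simp_all add: initial_store_def)
    fix s1 assume s1: "s1 2 0 = n \<and> (\<forall>a. a \<noteq> 2 \<longrightarrow> s1 a = ?s a)"
    let ?s2 = "upd s1 2 1 (3 * n * n)"
    show "runs (Seq (Assign 2 (Const 1) (Plus (Cell 1 (Const 0)) (Plus (Cell 1 (Const 0)) (Cell 1 (Const 0)))))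
     (Seq prog_rows (Seq (For 30 1 prog_round)
     (Seq (compile 0 f_answer) (Assign 1 (Const 0) (Cell 4 (Const 0))))))) s1
     (1 + ((n * (1 + 2) + 2) + ((3 * n * n * (round_time n + 2) + 2) + (fm_time f_answer n + 1)))) ?Q"
    proof (rule runs_Seq[where P = "\<lambda>s'. s' = ?s2"], rule runs_Assign)
      show "upd s1 2 (aval (Const 1) s1) (aval (Plus (Cell 1 (Const 0)) (Plus (Cell 1 (Const 0)) (Cell 1 (Const 0)))) s1) = ?s2"
      proof -
        have "aval (Plus (Cell 1 (Const 0)) (Plus (Cell 1 (Const 0)) (Cell 1 (Const 0)))) s1 = 3 * n * n"
          using s1 len by (simp add: initial_store_def mult.assoc)
        then show ?thesis by (simp only: aval.simps(1))
      qed
      fix s2 assume "s2 = ?s2"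
      then have s2: "s2 2 0 = n" "s2 2 1 = 3 * n * n" "\<And>a. a \<noteq> 2 \<Longrightarrow> s2 a = ?s a"
        using s1 by (auto simp: upd_def)
      show "runs (Seq prog_rows (Seq (For 30 1 prog_round)
         (Seq (compile 0 f_answer) (Assign 1 (Const 0) (Cell 4 (Const 0)))))) s2
         ((n * (1 + 2) + 2) + ((3 * n * n * (round_time n + 2) + 2) + (fm_time f_answer n + 1))) ?Q"
      proof (rule runs_Seq[OF runs_rows])
        show "s2 2 0 = n" "s2 5 0 = 0" using s2 by (simp_all add: initial_store_def)
        fix s3 assume s3: "(\<forall>i<n. s3 5 i = i * n) \<and> (\<forall>a. a \<noteq> 3 \<and> a \<noteq> 5 \<longrightarrow> s3 a = s2 a)"
        show "runs (Seq (For 30 1 prog_round)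
         (Seq (compile 0 f_answer) (Assign 1 (Const 0) (Cell 4 (Const 0))))) s3
         ((3 * n * n * (round_time n + 2) + 2) + (fm_time f_answer n + 1)) ?Q"
        proof (rule runs_Seq[OF runs_rounds])
          show "represents s3" using s2 s3 word by (simp add: represents_def)
          \<comment> \<open>The arrays from 10 on are still untouched, so no state is marked
            yet.\<close>
          have "s3 (10 + c) i = 0" for c i using s2 s3 by (simp add: initial_store_def)
          then show "alive s3 = states" by (auto simp: alive_def states_def)
          fix s4 assume s4: "represents s4 \<and>
            (covers (alive s4) \<longleftrightarrow> (\<exists>A\<subseteq>states. arc_consistent A \<and> covers A))"
          show "runs (Seq (compile 0 f_answer) (Assign 1 (Const 0) (Cell 4 (Const 0)))) s4
            (fm_time f_answer n + 1) ?Q"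
          proof (rule runs_Seq[OF runs_compile], rule stackfree_f_answer)
            show "s4 2 0 = n" using s4 represents_size by blast
            fix s5 assume "(\<forall>a. a \<noteq> 4 \<longrightarrow> s5 a = s4 a) \<and> (\<forall>i<0. s5 4 i = s4 4 i) \<and>
              s5 4 0 = of_bool (sat f_answer s4)"
            then show "runs (Assign 1 (Const 0) (Cell 4 (Const 0))) s5 1 ?Q"
              using s4 sat_f_answer[of s4] by (intro runs_Assign) (auto simp: upd_def)
          qed
        qed
      qed
    qed
  qed
qed

end

section \<open>Adjacency words and the passage from vertices to indices\<close>

lemma length_adjacency_word: "length (adjacency_word G xs) = length xs * length xs"
  by (simp add: adjacency_word_def length_concat comp_def sum_list_triv)

lemma nth_concat_rows:
  assumes "\<And>x. x \<in> set xs \<Longrightarrow> length (g x) = m" "i < length xs" "j < m"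
  shows "concat (map g xs) ! (i * m + j) = g (xs ! i) ! j"
  using assms
proof (induction xs arbitrary: i)
  case (Cons x xs)
  then show ?case by (cases i) (auto simp: nth_append)
qed simp

lemma nth_adjacency_word:
  assumes "i < length xs" "j < length xs"
  shows "adjacency_word G xs ! (i * length xs + j) \<longleftrightarrow> {xs ! i, xs ! j} \<in> edges G"
  unfolding adjacency_word_def using assms by (subst nth_concat_rows) auto

lemma rs3_colouring_iff_rel:
  "rs3_colouring G f \<longleftrightarrow> rs_colouring_rel (verts G) (\<lambda>x y. {x, y} \<in> edges G) f"
  by (simp add: rs3_colouring_def rs_colouring_rel_def)

lemma induced_cycle_iff_rel:
  "induced_cycle G xs \<longleftrightarrow> set xs \<subseteq> verts G \<and> induced_cycle_rel (\<lambda>x y. {x, y} \<in> edges G) xs"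
  by (auto simp: induced_cycle_def induced_cycle_rel_def)

text \<open>An edge-preserving map pulls proper colourings back; injectivity is needed in addition
  to keep the ends of a path distinct.\<close>

lemma rs_colouring_rel_transport:
  assumes b: "bij_betw g A B"
    and R: "\<And>x y. R x y \<Longrightarrow> x \<in> A \<and> y \<in> A" and S: "\<And>x y. S x y \<Longrightarrow> x \<in> B \<and> y \<in> B"
    and RS: "\<And>x y. x \<in> A \<Longrightarrow> y \<in> A \<Longrightarrow> R x y \<longleftrightarrow> S (g x) (g y)"
    and f: "rs_colouring_rel B S f"
  shows "rs_colouring_rel A R (f \<circ> g)"
  unfolding rs_colouring_rel_def
proof (intro conjI notI allI impI)
  show "(f \<circ> g) ` A \<subseteq> {0, 1, 2}"
    using f b unfolding rs_colouring_rel_def bij_betw_def image_comp[symmetric] by simp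
  have hom: "S (g x) (g y)" if "R x y" for x y using RS R that by blast
  show False if "R x y" "(f \<circ> g) x = (f \<circ> g) y" for x y
    using hom f that unfolding rs_colouring_rel_def by (metis comp_apply)
  assume "\<exists>x y z. R x y \<and> R y z \<and> x \<noteq> z \<and> (f \<circ> g) x < (f \<circ> g) y \<and> (f \<circ> g) x = (f \<circ> g) z"
  then obtain x y z where xyz: "R x y" "R y z" "x \<noteq> z" "f (g x) < f (g y)" "f (g x) = f (g z)" by auto
  then have "g x \<noteq> g z" using b R unfolding bij_betw_def inj_on_def by blast
  then show False using f hom xyz unfolding rs_colouring_rel_def by blast
qed

theorem theorem11:
  "poly_time_solvable encodes_graph
     {G :: nat graph. simple_graph G \<and> chordal G} rs3_colourable"
proof -
  obtain p where p: "\<And>n. total_time n \<le> poly p n"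
    using poly_bounded_total_time unfolding poly_bounded_def by blast
  have "\<exists>t s. exec prog_rs3 (initial_store w) t s \<and> t \<le> poly p (length w) \<and>
      (s 1 0 \<noteq> 0 \<longleftrightarrow> rs3_colourable G)"
    if G: "simple_graph G" "chordal G" and enc: "encodes_graph G w" for G :: "nat graph" and w
  proof -
    obtain xs where xs: "distinct xs" "set xs = verts G" "w = adjacency_word G xs"
      using enc unfolding encodes_graph_def by blast
    define n where "n = length xs"
    define R where "R = (\<lambda>x y. {x, y} \<in> edges G)"
    \<comment> \<open>The bounds are built in because \<open>xs ! i\<close> is unspecified beyond
      the end of the list.\<close>
    define E where "E = (\<lambda>i j. i < n \<and> j < n \<and> R (xs ! i) (xs ! j))"
    have R_verts: "x \<in> verts G \<and> y \<in> verts G \<and> x \<noteq> y" if "R x y" for x y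
    proof -
      have "{x, y} \<subseteq> verts G" "card {x, y} = 2"
        using G(1) that unfolding simple_graph_def R_def by auto
      then show ?thesis by (cases "x = y") auto
    qed
    interpret indexed_graph n E
    proof
      show "E y x" if "E x y" for x y using that by (simp add: E_def R_def insert_commute)
      show "\<not> E x x" for x using R_verts by (auto simp: E_def)
    qed (simp add: E_def)
    \<comment> \<open>As \<open>xs\<close> is distinct, replacing indices by vertices turns an
      induced cycle of \<open>E\<close> into one of \<open>G\<close>.\<close>
    have "length ys \<le> 3" if ys: "set ys \<subseteq> {..<n}" "induced_cycle_rel E ys" for ys
    proof -
      have less: "ys ! i < n" if "i < length ys" for i using that ys(1) nth_mem by blast
      have "inj_on ((!) xs) {..<n}" using xs(1) by (auto simp: n_def inj_on_def nth_eq_iff_index_eq)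
      then have "distinct (map ((!) xs) ys)"
        using ys by (auto simp: induced_cycle_rel_def distinct_map intro: inj_on_subset)
      moreover have "set (map ((!) xs) ys) \<subseteq> verts G"
        using ys(1) unfolding xs(2)[symmetric] by (auto simp: n_def)
      ultimately have "induced_cycle G (map ((!) xs) ys)"
        using ys(2) less by (auto simp: induced_cycle_iff_rel induced_cycle_rel_def E_def R_def)
      then show ?thesis using G(2) unfolding chordal_def by fastforce
    qed
    note char = colourable_iff_arc_consistent[OF this]
    have bij: "bij_betw ((!) xs) {..<n} (verts G)"
      using xs by (simp add: n_def bij_betw_nth)
    define ix where "ix = the_inv_into {..<n} ((!) xs)"
    have bij': "bij_betw ix (verts G) {..<n}"
      unfolding ix_def by (rule bij_betw_the_inv_into[OF bij])
    have ix: "ix x < n" "xs ! ix x = x" if "x \<in> verts G" for x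
      using that bij' f_the_inv_into_f_bij_betw[OF bij] unfolding ix_def bij_betw_def by auto
    have "rs3_colourable G \<longleftrightarrow> (\<exists>f. rs_colouring_rel {..<n} E f)"
    proof
      assume "rs3_colourable G"
      then obtain f where "rs_colouring_rel (verts G) R f"
        unfolding rs3_colourable_def rs3_colouring_iff_rel R_def by blast
      then have "rs_colouring_rel {..<n} E (f \<circ> (!) xs)"
        by (rule rs_colouring_rel_transport[OF bij, rotated -1]) (auto simp: E_def dest: R_verts)
      then show "\<exists>f. rs_colouring_rel {..<n} E f" by blast
    next
      assume "\<exists>f. rs_colouring_rel {..<n} E f"
      then obtain f where "rs_colouring_rel {..<n} E f" by blast
      then have "rs_colouring_rel (verts G) R (f \<circ> ix)"
        by (rule rs_colouring_rel_transport[OF bij', rotated -1]) (auto simp: E_def ix dest: R_verts)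
      then show "rs3_colourable G"
        unfolding rs3_colourable_def rs3_colouring_iff_rel R_def by blast
    qed
    moreover have len: "length w = n * n" using xs(3) by (simp add: length_adjacency_word n_def)
    moreover have "w ! (i * n + j) \<longleftrightarrow> E i j" if "i < n" "j < n" for i j
      using that nth_adjacency_word[of i xs j G] xs(3) by (simp add: E_def R_def n_def)
    ultimately have "runs prog_rs3 (initial_store w) (total_time n) (\<lambda>s'. s' 1 0 \<noteq> 0 \<longleftrightarrow> rs3_colourable G)"
      using runs_prog_rs3[of w] char by simp
    \<comment> \<open>The time is bounded in terms of \<open>n\<close>, but the word has length
      \<open>n * n\<close>. By monotonicity and \<open>n \<le> n * n\<close> the same
      \<open>p\<close> serves.\<close>
    moreover have "total_time n \<le> poly p (length w)"
      using p[of n] poly_nat_mono[of n "n * n" p] len by (simp add: le_trans)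
    ultimately show ?thesis unfolding runs_def by (meson le_trans)
  qed
  then show ?thesis unfolding poly_time_solvable_def by blast
qed

end
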